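(* Let $(\mathcal{X}\times\mathcal{Y},\sigma_{XY},P_{XY})$ be a probability space, where $\sigma_{XY}$ is the product sigma-algebra, with associated (marginal) probability spaces $(\mathcal{X},\sigma_X,P_X)$ and $(\mathcal{Y},\sigma_Y,P_Y)$. Assume $P_{XY}\ll P_X\times P_Y$ and that $\sigma_X$ is generated by a countable collection of sets. Then: 1) $\mathcal{L}(X\to Y)=0$ if and only if $X$ and $Y$ are independent. 2) (Additivity) If $(X_i,Y_i)$, $i=1,\dots,n$, are mutually independent pairs, where for each $i$ the pair $(X_i,Y_i)$ takes values in a product space $\mathcal{X}_i\times\mathcal{Y}_i$ equipped with the product sigma-algebra of $\sigma_{X_i}$ and $\sigma_{Y_i}$, $P_{X_iY_i}\ll P_{X_i}\times P_{Y_i}$, and $\sigma_{X_i}$ is generated by a countable collection of sets, then $\mathcal{L}(X_1^n\to Y_1^n)=\sum_{i=1}^n\mathcal{L}(X_i\to Y_i)$. 3) $\mathcal{L}(X\to Y)\ge I(X;Y)$.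
   Context: $\log$ is the natural logarithm (also used in mutual information). Dashes denote Markov chains. The maximal leakage is $$\mathcal{L}(X\to Y)=\sup_{U-X-Y-\hat U}\log\frac{\Pr(U=\hat U)}{\max_{u}P_U(u)},$$ the supremum being over all $U,\hat U$ taking values in the same finite, but arbitrary, alphabet. $X_1^n=(X_1,\dots,X_n)$, $Y_1^n=(Y_1,\dots,Y_n)$. *)

theory Defs
  imports "HOL-Probability.Probability" "HOL-Probability.Information"
begin

definition countably_generated :: "'a measure \<Rightarrow> bool" where
  "countably_generated M \<longleftrightarrow>
    (\<exists>G. countable G \<and> G \<subseteq> Pow (space M) \<and> sets M = sigma_sets (space M) G)"

text \<open>Natural logarithm with \<open>log 0 = -\<infinity>\<close> (the library has \<open>ln 0 = 0\<close>).\<close>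

definition elog :: "real \<Rightarrow> ereal" where
  "elog r = (if r = 0 then -\<infinity> else ereal (ln r))"

text \<open>\<open>KL_divergence\<close> is a Bochner integral, hence \<open>0\<close> when the entropy density is not integrable.
  Here the value is extended: the integrals of the positive and of the negative part are
  subtracted (\<^const>\<open>ennreal\<close> truncates negative numbers to \<open>0\<close>), and the latter is
  always finite for probability measures. As in the library, \<open>N\<close> is the measure that is
  differentiated and integrated against, so this is \<open>D(N || M)\<close>.\<close>

definition ext_KL_divergence :: "'a measure \<Rightarrow> 'a measure \<Rightarrow> ereal" where
  "ext_KL_divergence M N =
    (if absolutely_continuous M N
     then enn2ereal (\<integral>\<^sup>+ x. ennreal (entropy_density (exp 1) M N x) \<partial>N)
        - enn2ereal (\<integral>\<^sup>+ x. ennreal (- entropy_density (exp 1) M N x) \<partial>N)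
     else \<infinity>)"

context prob_space
begin

definition ext_mutual_information ::
  "'b measure \<Rightarrow> 'c measure \<Rightarrow> ('a \<Rightarrow> 'b) \<Rightarrow> ('a \<Rightarrow> 'c) \<Rightarrow> ereal" where
  "ext_mutual_information S T X Y =
    ext_KL_divergence (distr M S X \<Otimes>\<^sub>M distr M T Y) (distr M (S \<Otimes>\<^sub>M T) (\<lambda>\<omega>. (X \<omega>, Y \<omega>)))"

text \<open>Conditional independence of \<open>X\<close> and \<open>Z\<close> given \<open>Y\<close>, i.e. the Markov chain \<open>X - Y - Z\<close>.\<close>

definition markov_chain3 ::
  "'b measure \<Rightarrow> 'c measure \<Rightarrow> 'd measure \<Rightarrow> ('a \<Rightarrow> 'b) \<Rightarrow> ('a \<Rightarrow> 'c) \<Rightarrow> ('a \<Rightarrow> 'd) \<Rightarrow> bool" where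
  "markov_chain3 MX MY MZ X Y Z \<longleftrightarrow>
    random_variable MX X \<and> random_variable MY Y \<and> random_variable MZ Z \<and>
    (\<forall>A\<in>sets MX. \<forall>B\<in>sets MZ. AE \<omega> in M.
      real_cond_exp M (vimage_algebra (space M) Y MY)
        (indicator {\<omega>' \<in> space M. X \<omega>' \<in> A \<and> Z \<omega>' \<in> B}) \<omega> =
      real_cond_exp M (vimage_algebra (space M) Y MY) (indicator {\<omega>' \<in> space M. X \<omega>' \<in> A}) \<omega> *
      real_cond_exp M (vimage_algebra (space M) Y MY) (indicator {\<omega>' \<in> space M. Z \<omega>' \<in> B}) \<omega>)"

text \<open>\<open>W - X - Y - Z\<close>: past and future are conditionally independent given the present.\<close>

definition markov_chain4 ::
  "'b measure \<Rightarrow> 'c measure \<Rightarrow> 'd measure \<Rightarrow> 'e measure \<Rightarrow>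
   ('a \<Rightarrow> 'b) \<Rightarrow> ('a \<Rightarrow> 'c) \<Rightarrow> ('a \<Rightarrow> 'd) \<Rightarrow> ('a \<Rightarrow> 'e) \<Rightarrow> bool" where
  "markov_chain4 MW MX MY MZ W X Y Z \<longleftrightarrow>
    markov_chain3 MW MX (MY \<Otimes>\<^sub>M MZ) W X (\<lambda>\<omega>. (Y \<omega>, Z \<omega>)) \<and>
    markov_chain3 (MW \<Otimes>\<^sub>M MX) MY MZ (\<lambda>\<omega>. (W \<omega>, X \<omega>)) Y Z"

end

text \<open>Joint laws of \<open>(U, X, Y, V)\<close> in which \<open>(X, Y)\<close> has law \<open>P\<close> and \<open>U - X - Y - V\<close>, where
  \<open>V\<close> stands for the guess of \<open>U\<close>. Every finite alphabet is, up to renaming of its letters, a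
  finite set \<open>A\<close> of natural numbers.\<close>

definition guessing_laws ::
  "'b measure \<Rightarrow> 'c measure \<Rightarrow> ('b \<times> 'c) measure \<Rightarrow> nat set \<Rightarrow> (nat \<times> 'b \<times> 'c \<times> nat) measure set" where
  "guessing_laws MX MY P A =
    {Q. prob_space Q \<and>
        sets Q = sets (count_space A \<Otimes>\<^sub>M MX \<Otimes>\<^sub>M MY \<Otimes>\<^sub>M count_space A) \<and>
        distr Q (MX \<Otimes>\<^sub>M MY) (\<lambda>(u, x, y, v). (x, y)) = P \<and>
        prob_space.markov_chain4 Q (count_space A) MX MY (count_space A)
          (\<lambda>(u, x, y, v). u) (\<lambda>(u, x, y, v). x) (\<lambda>(u, x, y, v). y) (\<lambda>(u, x, y, v). v)}"

definition (in prob_space) maximal_leakage ::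
  "'b measure \<Rightarrow> 'c measure \<Rightarrow> ('a \<Rightarrow> 'b) \<Rightarrow> ('a \<Rightarrow> 'c) \<Rightarrow> ereal" where
  "maximal_leakage MX MY X Y =
    (SUP (A, Q) \<in> (SIGMA A:{A. finite A}.
                     guessing_laws MX MY (distr M (MX \<Otimes>\<^sub>M MY) (\<lambda>\<omega>. (X \<omega>, Y \<omega>))) A).
      elog (measure Q {(u, x, y, v) \<in> space Q. u = v} /
            Max ((\<lambda>a. measure Q {(u, x, y, v) \<in> space Q. u = a}) ` A)))"

end

(*
  The maximal leakage satisfies
    exp L(X -> Y) = sup sum_j P(Y in B_j | X in A_j),
  the supremum being over finitely many events A_j of X and disjoint events B_j of Y
  (null events A_j contribute 0, since x / 0 = 0).
  A sum on the right is attained by a U that has conditional law c 1[x in A_u] / P(X in A_u) given X on the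
  first letters and spreads the remaining mass over so many dummy letters that no letter has mass above c;
  the guess is j on B_j. Conversely, if the supremum s is finite, then the supremum g of countably many
  conditional densities dP(Y in . | X in A) / dP_Y satisfies E g(Y) <= s and
    P(X in A, Y in B) <= P(X in A) E[g(Y); Y in B]   for all A, B,
  and through the Markov chain this gives P(U = V) <= max_u P(U = u) E g(Y).
  The domination is equality with g = 1 exactly under independence, it tensorises (products of the g's),
  and it bounds dP_XY / d(P_X x P_Y) by g, so that the mutual information is at most
  E ln g(Y) <= ln s + E g(Y) / s - 1 <= ln s.
*)

theory Submission
  imports Defs
begin

text \<open>In general spaces there need be no conditional law of Y given X = x, so nothing is
  conditioned on points: every domination is an inequality between integrals over events, and
  \<open>nn_integral_subalgebra_le\<close> turns tests on the events of a sub-sigma-algebra into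
  weighted inequalities. This device carries g through both halves of the Markov chain and,
  coordinate by coordinate, through products. The sums and g form a primal-dual pair. The tight g
  would be a supremum over all events A, an uncountable family. Instead, the densities are collected
  along a maximising sequence of sums; a further A must then lie below g almost everywhere, as
  otherwise the integral would exceed the finite supremum s. For s infinite no g is required,
  because the upper bounds are then trivial. The information bound meets another obstacle:
  domination is known on rectangles only, and a Dynkin argument cannot extend an inequality, since
  complements reverse it. The difference of the two measures is therefore constructed as a measure,
  which turns the inequality into an equation.\<close>

section \<open>Conditional expectations and Markov chains\<close>

text \<open>The hypothesis orders the restrictions to F of the measures f dM and g dM, and an
  F-measurable q has the same integral against a restriction as against the original. Since f and g
  are never conditioned on F, infinite values do no harm.\<close>

lemma nn_integral_subalgebra_le:
  fixes f g q :: "'a \<Rightarrow> ennreal"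
  assumes sub: "subalgebra M F"
    and [measurable]: "f \<in> borel_measurable M" "g \<in> borel_measurable M" and q: "q \<in> borel_measurable F"
    and le: "\<And>E. E \<in> sets F \<Longrightarrow> (\<integral>\<^sup>+x. f x * indicator E x \<partial>M) \<le> (\<integral>\<^sup>+x. g x * indicator E x \<partial>M)"
  shows "(\<integral>\<^sup>+x. f x * q x \<partial>M) \<le> (\<integral>\<^sup>+x. g x * q x \<partial>M)"
proof -
  have sub': "subalgebra (density M h) F" for h
    using sub by (simp add: subalgebra_def)
  have [measurable]: "q \<in> borel_measurable M"
    by (rule measurable_from_subalg[OF sub q])
  have restr: "(\<integral>\<^sup>+x. h x * q x \<partial>M) = (\<integral>\<^sup>+x. q x \<partial>restr_to_subalg (density M h) F)"
    if [measurable]: "h \<in> borel_measurable M" for h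
    using q by (simp add: nn_integral_subalgebra2[OF sub'] nn_integral_density)
  have "restr_to_subalg (density M f) F \<le> restr_to_subalg (density M g) F"
  proof (subst le_measure)
    show "sets (restr_to_subalg (density M f) F) = sets (restr_to_subalg (density M g) F)"
      using sets_restr_to_subalg[OF sub'] by metis
    show "\<forall>A\<in>sets (restr_to_subalg (density M f) F).
       emeasure (restr_to_subalg (density M f) F) A \<le> emeasure (restr_to_subalg (density M g) F) A"
    proof
      fix A assume "A \<in> sets (restr_to_subalg (density M f) F)"
      then have A: "A \<in> sets F" using sets_restr_to_subalg[OF sub'] by auto
      then have "A \<in> sets M" using sub by (auto simp: subalgebra_def)
      then show "emeasure (restr_to_subalg (density M f) F) A \<le> emeasure (restr_to_subalg (density M g) F) A"
        using le[OF A] A by (simp add: emeasure_restr_to_subalg[OF sub'] emeasure_density)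
    qed
  qed
  moreover have "sets (restr_to_subalg (density M f) F) = sets (restr_to_subalg (density M g) F)"
    using sets_restr_to_subalg[OF sub'] by metis
  ultimately have "(\<integral>\<^sup>+x. q x \<partial>restr_to_subalg (density M f) F) \<le> (\<integral>\<^sup>+x. q x \<partial>restr_to_subalg (density M g) F)"
    by (intro nn_integral_mono_measure)
  then show ?thesis by (simp add: restr)
qed

lemma nn_integral_indicator_times:
  assumes "S \<in> sets M" "T \<in> sets M"
  shows "(\<integral>\<^sup>+x. indicator S x * indicator T x \<partial>M) = emeasure M (S \<inter> T)"
proof -
  have "indicator S x * indicator T x = (indicator (S \<inter> T) x :: ennreal)" for x
    by (simp split: split_indicator)
  then show ?thesis using assms by simp
qed

lemma subalgebra_vimage_algebra:
  "X \<in> measurable M N \<Longrightarrow> subalgebra M (vimage_algebra (space M) X N)"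
  unfolding subalgebra_def by (auto simp: sets_vimage_algebra2 measurable_space)

lemma sets_vimage_algebra_measurable:
  "X \<in> measurable M N \<Longrightarrow>
    sets (vimage_algebra (space M) X N) = {X -` A \<inter> space M | A. A \<in> sets N}"
  by (rule sets_vimage_algebra2) (auto dest: measurable_space)

lemma measurable_comp_vimage_algebra:
  "X \<in> measurable M N \<Longrightarrow> f \<in> measurable N K \<Longrightarrow>
    (\<lambda>x. f (X x)) \<in> measurable (vimage_algebra (space M) X N) K"
  by (rule measurable_compose[OF measurable_vimage_algebra1]) (auto dest: measurable_space)

text \<open>The defining property of conditional probability, for weights q that may be infinite or
  not integrable. Equality on the events of F gives both inequalities of
  \<open>nn_integral_subalgebra_le\<close>.\<close>

lemma (in finite_measure_subalgebra) nn_integral_real_cond_exp_indicator: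
  assumes C[measurable]: "C \<in> sets M" and q: "q \<in> borel_measurable F"
  shows "(\<integral>\<^sup>+x. ennreal (real_cond_exp M F (indicator C) x) * q x \<partial>M) = (\<integral>\<^sup>+x. indicator C x * q x \<partial>M)"
proof -
  have eq: "(\<integral>\<^sup>+x. ennreal (real_cond_exp M F (indicator C) x) * indicator E x \<partial>M)
      = (\<integral>\<^sup>+x. indicator C x * indicator E x \<partial>M)" if E: "E \<in> sets F" for E
  proof -
    have E': "E \<in> sets M" using E subalg by (auto simp: subalgebra_def)
    have iC: "integrable M (indicator C :: _ \<Rightarrow> real)"
      by (rule integrable_real_indicator) (auto simp: less_top[symmetric])
    have pos: "AE x in M. 0 \<le> real_cond_exp M F (indicator C) x"
      by (rule real_cond_exp_pos) auto
    have "(\<integral>\<^sup>+x. ennreal (real_cond_exp M F (indicator C) x) * indicator E x \<partial>M)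
        = (\<integral>\<^sup>+x. ennreal (indicator E x * real_cond_exp M F (indicator C) x) \<partial>M)"
      by (intro nn_integral_cong) (auto split: split_indicator)
    also have "\<dots> = ennreal (\<integral>x. indicator E x * real_cond_exp M F (indicator C) x \<partial>M)"
    proof (rule nn_integral_eq_integral)
      show "integrable M (\<lambda>x. indicator E x * real_cond_exp M F (indicator C) x)"
        using integrable_real_mult_indicator[OF E' real_cond_exp_int(1)[OF iC]] by (simp add: mult.commute)
    qed (use pos in auto)
    also have "(\<integral>x. indicator E x * real_cond_exp M F (indicator C) x \<partial>M)
        = (\<integral>x. indicator E x * indicator C x \<partial>M)"
      using real_cond_exp_intA[OF iC E] by (simp add: set_lebesgue_integral_def)
    also have "ennreal \<dots> = emeasure M (E \<inter> C)"
      using E' by (simp add: indicator_inter_arith[symmetric] emeasure_eq_measure)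
    also have "\<dots> = (\<integral>\<^sup>+x. indicator C x * indicator E x \<partial>M)"
      using E' by (simp add: nn_integral_indicator_times Int_commute)
    finally show ?thesis .
  qed
  show ?thesis
    by (rule antisym; rule nn_integral_subalgebra_le[OF subalg _ _ q]) (simp_all add: eq)
qed

text \<open>Taking expectations in the product formula leaves E[P(X in A | Y) P(Z in C | Y)]. The
  second factor is measurable in Y, so the first may be replaced by the indicator of X in A. The
  remaining factor serves as the weight q of \<open>nn_integral_subalgebra_le\<close>.\<close>

lemma (in prob_space) markov_chain3_nn_integral:
  assumes mc: "markov_chain3 MX MY MZ X Y Z" and A: "A \<in> sets MX" and C: "C \<in> sets MZ"
  shows "emeasure M {\<omega> \<in> space M. X \<omega> \<in> A \<and> Z \<omega> \<in> C} =
    (\<integral>\<^sup>+\<omega>. indicator {\<omega> \<in> space M. X \<omega> \<in> A} \<omega> *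
      ennreal (real_cond_exp M (vimage_algebra (space M) Y MY) (indicator {\<omega> \<in> space M. Z \<omega> \<in> C}) \<omega>) \<partial>M)"
proof -
  let ?F = "vimage_algebra (space M) Y MY"
  let ?A = "{\<omega> \<in> space M. X \<omega> \<in> A}" and ?C = "{\<omega> \<in> space M. Z \<omega> \<in> C}"
  let ?AC = "{\<omega> \<in> space M. X \<omega> \<in> A \<and> Z \<omega> \<in> C}"
  let ?a = "real_cond_exp M ?F (indicator ?A)" and ?c = "real_cond_exp M ?F (indicator ?C)"
  have [measurable]: "random_variable MX X" "random_variable MY Y" "random_variable MZ Z"
    using mc by (auto simp: markov_chain3_def)
  interpret finite_measure_subalgebra M ?F
    by unfold_locales (rule subalgebra_vimage_algebra, simp)
  have [measurable]: "?A \<in> events" "?C \<in> events" "?AC \<in> events"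
    using A C by auto
  have ae: "AE \<omega> in M. real_cond_exp M ?F (indicator ?AC) \<omega> = ?a \<omega> * ?c \<omega>"
    using mc A C by (auto simp: markov_chain3_def)
  have pos: "AE \<omega> in M. 0 \<le> ?a \<omega>" "AE \<omega> in M. 0 \<le> ?c \<omega>"
    by (rule real_cond_exp_pos; auto)+
  have "emeasure M ?AC = (\<integral>\<^sup>+\<omega>. indicator ?AC \<omega> * 1 \<partial>M)"
    by simp
  also have "\<dots> = (\<integral>\<^sup>+\<omega>. ennreal (real_cond_exp M ?F (indicator ?AC) \<omega>) * 1 \<partial>M)"
    by (rule nn_integral_real_cond_exp_indicator[symmetric]) auto
  also have "\<dots> = (\<integral>\<^sup>+\<omega>. ennreal (?a \<omega>) * ennreal (?c \<omega>) \<partial>M)"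
    using ae pos by (intro nn_integral_cong_AE) (auto simp: ennreal_mult)
  also have "\<dots> = (\<integral>\<^sup>+\<omega>. indicator ?A \<omega> * ennreal (?c \<omega>) \<partial>M)"
    by (rule nn_integral_real_cond_exp_indicator) auto
  finally show ?thesis .
qed

lemma (in prob_space) markov_chain3_commute:
  "markov_chain3 MX MY MZ X Y Z \<Longrightarrow> markov_chain3 MZ MY MX Z Y X"
  unfolding markov_chain3_def by (simp add: conj_commute mult.commute)

text \<open>The hypothesis provides a function r of Y that acts as the probability of Z in C even on
  the events X in A. Then P(X in A, Z in C | Y) = r(Y) P(X in A | Y), while A =
  \<open>space MX\<close> shows that r(Y) is P(Z in C | Y). The bounds on r supply
  integrability.\<close>

lemma (in prob_space) markov_chain3I:
  assumes [measurable]: "random_variable MX X" "random_variable MY Y" "random_variable MZ Z"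
    and ex: "\<And>C. C \<in> sets MZ \<Longrightarrow> \<exists>r\<in>borel_measurable MY. (\<forall>y. 0 \<le> r y \<and> r y \<le> 1) \<and>
      (\<forall>A\<in>sets MX. \<forall>B\<in>sets MY. emeasure M {\<omega> \<in> space M. X \<omega> \<in> A \<and> Y \<omega> \<in> B \<and> Z \<omega> \<in> C} =
         (\<integral>\<^sup>+\<omega>. ennreal (r (Y \<omega>)) * indicator {\<omega> \<in> space M. X \<omega> \<in> A \<and> Y \<omega> \<in> B} \<omega> \<partial>M))"
  shows "markov_chain3 MX MY MZ X Y Z"
  unfolding markov_chain3_def
proof (intro conjI ballI)
  let ?F = "vimage_algebra (space M) Y MY"
  interpret finite_measure_subalgebra M ?F
    by unfold_locales (rule subalgebra_vimage_algebra, simp)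
  fix A C assume A[measurable]: "A \<in> sets MX" and C[measurable]: "C \<in> sets MZ"
  let ?A = "{\<omega> \<in> space M. X \<omega> \<in> A}" and ?C = "{\<omega> \<in> space M. Z \<omega> \<in> C}"
  let ?AC = "{\<omega> \<in> space M. X \<omega> \<in> A \<and> Z \<omega> \<in> C}"
  let ?a = "real_cond_exp M ?F (indicator ?A)"
  from ex[OF C] obtain r where r[measurable]: "r \<in> borel_measurable MY"
    and r01: "\<And>y. 0 \<le> r y" "\<And>y. r y \<le> 1"
    and req: "\<And>A B. A \<in> sets MX \<Longrightarrow> B \<in> sets MY \<Longrightarrow>
      emeasure M {\<omega> \<in> space M. X \<omega> \<in> A \<and> Y \<omega> \<in> B \<and> Z \<omega> \<in> C} =
         (\<integral>\<^sup>+\<omega>. ennreal (r (Y \<omega>)) * indicator {\<omega> \<in> space M. X \<omega> \<in> A \<and> Y \<omega> \<in> B} \<omega> \<partial>M)"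
    by blast
  have int_ind: "integrable M (indicator D :: _ \<Rightarrow> real)" if "D \<in> events" for D
    using that by (intro integrable_real_indicator) (auto simp: less_top[symmetric])
  have int_r: "integrable M (\<lambda>\<omega>. r (Y \<omega>) * indicator D \<omega>)" if [measurable]: "D \<in> events" for D
    by (rule integrable_const_bound[where B=1]) (auto simp: r01 split: split_indicator)
  have rF: "(\<lambda>\<omega>. r (Y \<omega>)) \<in> borel_measurable ?F"
    by (rule measurable_comp_vimage_algebra) auto
  \<comment> \<open>The events of \<open>?F\<close> are the preimages under Y, so this is the
    hypothesis on r, rewritten as a Bochner integral over E.\<close>
  have key: "(\<integral>\<omega>\<in>E. indicator {\<omega> \<in> space M. X \<omega> \<in> A' \<and> Z \<omega> \<in> C} \<omega> \<partial>M) =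
      (\<integral>\<omega>. r (Y \<omega>) * indicator {\<omega> \<in> space M. X \<omega> \<in> A' \<and> \<omega> \<in> E} \<omega> \<partial>M)"
    if A'[measurable]: "A' \<in> sets MX" and E: "E \<in> sets ?F" for A' E
  proof -
    obtain B where B[measurable]: "B \<in> sets MY" and EB: "E = Y -` B \<inter> space M"
      using E by (auto simp: sets_vimage_algebra_measurable)
    have "(\<integral>\<omega>\<in>E. indicator {\<omega> \<in> space M. X \<omega> \<in> A' \<and> Z \<omega> \<in> C} \<omega> \<partial>M) =
        (\<integral>\<omega>. indicator {\<omega> \<in> space M. X \<omega> \<in> A' \<and> Y \<omega> \<in> B \<and> Z \<omega> \<in> C} \<omega> \<partial>M)"
      unfolding set_lebesgue_integral_def EB
      by (intro Bochner_Integration.integral_cong) (auto split: split_indicator)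
    also have "\<dots> = measure M {\<omega> \<in> space M. X \<omega> \<in> A' \<and> Y \<omega> \<in> B \<and> Z \<omega> \<in> C}"
      by simp
    also have "\<dots> = (\<integral>\<omega>. r (Y \<omega>) * indicator {\<omega> \<in> space M. X \<omega> \<in> A' \<and> Y \<omega> \<in> B} \<omega> \<partial>M)"
    proof -
      have "ennreal (measure M {\<omega> \<in> space M. X \<omega> \<in> A' \<and> Y \<omega> \<in> B \<and> Z \<omega> \<in> C}) =
         (\<integral>\<^sup>+\<omega>. ennreal (r (Y \<omega>) * indicator {\<omega> \<in> space M. X \<omega> \<in> A' \<and> Y \<omega> \<in> B} \<omega>) \<partial>M)"
        unfolding emeasure_eq_measure[symmetric] req[OF A' B]
        by (intro nn_integral_cong) (auto simp: ennreal_mult r01 split: split_indicator)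
      also have "\<dots> = ennreal (\<integral>\<omega>. r (Y \<omega>) * indicator {\<omega> \<in> space M. X \<omega> \<in> A' \<and> Y \<omega> \<in> B} \<omega> \<partial>M)"
        by (rule nn_integral_eq_integral) (auto simp: r01 intro!: int_r)
      finally show ?thesis
        by (subst (asm) ennreal_inj) (auto intro!: integral_nonneg_AE simp: r01)
    qed
    also have "\<dots> = (\<integral>\<omega>. r (Y \<omega>) * indicator {\<omega> \<in> space M. X \<omega> \<in> A' \<and> \<omega> \<in> E} \<omega> \<partial>M)"
      unfolding EB by (intro Bochner_Integration.integral_cong) (auto split: split_indicator)
    finally show ?thesis .
  qed
  have inta: "integrable M (\<lambda>\<omega>. r (Y \<omega>) * ?a \<omega>)"
    by (rule real_cond_exp_intg) (auto intro!: int_r rF)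
  have ca: "AE \<omega> in M. real_cond_exp M ?F (indicator ?AC) \<omega> = r (Y \<omega>) * ?a \<omega>"
  proof (rule real_cond_exp_charact)
    fix E assume E: "E \<in> sets ?F"
    have E'[measurable]: "E \<in> events" using E subalg by (auto simp: subalgebra_def)
    have intE: "integrable M (\<lambda>\<omega>. r (Y \<omega>) * indicator E \<omega> * indicator ?A \<omega>)"
      using int_r[of "E \<inter> ?A"] by (simp add: indicator_inter_arith mult.assoc)
    have "(\<integral>\<omega>\<in>E. r (Y \<omega>) * ?a \<omega> \<partial>M) = (\<integral>\<omega>. r (Y \<omega>) * indicator E \<omega> * ?a \<omega> \<partial>M)"
      by (simp add: set_lebesgue_integral_def mult_ac)
    also have "\<dots> = (\<integral>\<omega>. r (Y \<omega>) * indicator E \<omega> * indicator ?A \<omega> \<partial>M)"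
      using E rF by (intro real_cond_exp_intg(2) intE) auto
    also have "\<dots> = (\<integral>\<omega>. r (Y \<omega>) * indicator {\<omega> \<in> space M. X \<omega> \<in> A \<and> \<omega> \<in> E} \<omega> \<partial>M)"
      by (intro Bochner_Integration.integral_cong) (auto split: split_indicator)
    finally show "(\<integral>\<omega>\<in>E. indicator ?AC \<omega> \<partial>M) = (\<integral>\<omega>\<in>E. r (Y \<omega>) * ?a \<omega> \<partial>M)"
      using key[OF A E] by simp
  qed (auto intro!: int_ind inta rF borel_measurable_times)
  \<comment> \<open>The case of \<open>key\<close> in which the event on X is the whole
    space.\<close>
  have cc: "AE \<omega> in M. real_cond_exp M ?F (indicator ?C) \<omega> = r (Y \<omega>)"
  proof (rule real_cond_exp_charact)
    fix E assume E: "E \<in> sets ?F"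
    have "(\<integral>\<omega>\<in>E. indicator ?C \<omega> \<partial>M) =
       (\<integral>\<omega>\<in>E. indicator {\<omega> \<in> space M. X \<omega> \<in> space MX \<and> Z \<omega> \<in> C} \<omega> \<partial>M)"
      unfolding set_lebesgue_integral_def
      by (intro Bochner_Integration.integral_cong) (auto split: split_indicator dest: measurable_space[OF assms(1)])
    also have "\<dots> = (\<integral>\<omega>. r (Y \<omega>) * indicator {\<omega> \<in> space M. X \<omega> \<in> space MX \<and> \<omega> \<in> E} \<omega> \<partial>M)"
      by (rule key[OF sets.top E])
    also have "\<dots> = (\<integral>\<omega>\<in>E. r (Y \<omega>) \<partial>M)"
      unfolding set_lebesgue_integral_def
      by (intro Bochner_Integration.integral_cong) (auto split: split_indicator dest: measurable_space[OF assms(1)])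
    finally show "(\<integral>\<omega>\<in>E. indicator ?C \<omega> \<partial>M) = (\<integral>\<omega>\<in>E. r (Y \<omega>) \<partial>M)" .
  qed (use int_r[of "space M"] in \<open>auto intro!: int_ind rF cong: Bochner_Integration.integrable_cong\<close>)
  show "AE \<omega> in M. real_cond_exp M ?F (indicator ?AC) \<omega> = ?a \<omega> * real_cond_exp M ?F (indicator ?C) \<omega>"
    using ca cc by eventually_elim simp
qed auto

section \<open>The guessing gain of a joint law and its dual\<close>

text \<open>Exponential of the maximal leakage. For discrete X and Y it is the sum over y of sup_x
  P(y | x), over x of positive probability. The B_j are decision regions and must be disjoint; the
  A_j may overlap or repeat.\<close>

definition guessing_gain :: "'b measure \<Rightarrow> 'c measure \<Rightarrow> ('b \<times> 'c) measure \<Rightarrow> ennreal" where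
  "guessing_gain MX MY P =
    (SUP (n, A, B) \<in> {(n :: nat, A, B). A \<in> {..<n} \<rightarrow> sets MX \<and> B \<in> {..<n} \<rightarrow> sets MY \<and>
        disjoint_family_on B {..<n}}.
      ennreal (\<Sum>j<n. measure P (A j \<times> B j) / measure P (A j \<times> space MY)))"

text \<open>The dual variable: the single measure g dP_Y dominates every conditional law of Y given
  an event of X. Integrating over P through \<open>snd\<close> saves naming the marginals.\<close>

definition leakage_density ::
  "'b measure \<Rightarrow> 'c measure \<Rightarrow> ('b \<times> 'c) measure \<Rightarrow> ('c \<Rightarrow> ennreal) \<Rightarrow> bool" where
  "leakage_density MX MY P g \<longleftrightarrow> g \<in> borel_measurable MY \<and>
    (\<forall>A\<in>sets MX. \<forall>B\<in>sets MY. emeasure P (A \<times> B) \<le>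
      emeasure P (A \<times> space MY) * (\<integral>\<^sup>+z. g (snd z) * indicator B (snd z) \<partial>P))"

locale joint_law = prob_space P for P :: "('b \<times> 'c) measure" +
  fixes MX :: "'b measure" and MY :: "'c measure"
  assumes sets_joint[measurable_cong]: "sets P = sets (MX \<Otimes>\<^sub>M MY)"
begin

lemma space_joint: "space P = space MX \<times> space MY"
  using sets_eq_imp_space_eq[OF sets_joint] by (simp add: space_pair_measure)

lemma measurable_fst_joint[measurable]: "fst \<in> measurable P MX"
  and measurable_snd_joint[measurable]: "snd \<in> measurable P MY"
  by (simp_all add: measurable_cong_sets[OF sets_joint refl])

lemma rectangle_joint: "A \<in> sets MX \<Longrightarrow> B \<in> sets MY \<Longrightarrow> A \<times> B \<in> sets P"
  by (simp add: sets_joint)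

lemma guessing_gain_ge:
  fixes A :: "nat \<Rightarrow> 'b set"
  assumes "\<And>j. j < n \<Longrightarrow> A j \<in> sets MX" "\<And>j. j < n \<Longrightarrow> B j \<in> sets MY" "disjoint_family_on B {..<n}"
  shows "ennreal (\<Sum>j<n. measure P (A j \<times> B j) / measure P (A j \<times> space MY)) \<le> guessing_gain MX MY P"
  unfolding guessing_gain_def using assms by (intro SUP_upper2[of "(n, A, B)"]) auto

text \<open>Product laws give sums indexed by choice functions, which are renumbered here.\<close>

lemma guessing_gain_ge_finite:
  assumes I: "finite I" and AB: "\<And>j. j \<in> I \<Longrightarrow> A j \<in> sets MX" "\<And>j. j \<in> I \<Longrightarrow> B j \<in> sets MY"
    "disjoint_family_on B I"
  shows "ennreal (\<Sum>j\<in>I. measure P (A j \<times> B j) / measure P (A j \<times> space MY)) \<le> guessing_gain MX MY P"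
proof -
  obtain h where h: "bij_betw h {..<card I} I"
    using ex_bij_betw_nat_finite[OF I] by (auto simp: atLeast0LessThan)
  have hI: "h j \<in> I" if "j < card I" for j
    using h that by (auto simp: bij_betw_def)
  have "(\<Sum>j\<in>I. measure P (A j \<times> B j) / measure P (A j \<times> space MY)) =
      (\<Sum>j<card I. measure P (A (h j) \<times> B (h j)) / measure P (A (h j) \<times> space MY))"
    by (rule sum.reindex_bij_betw[OF h, symmetric])
  moreover have "disjoint_family_on (\<lambda>j. B (h j)) {..<card I}"
    using AB(3) h unfolding disjoint_family_on_def bij_betw_def
    by (metis hI inj_on_eq_iff lessThan_iff)
  ultimately show ?thesis
    using guessing_gain_ge[of "card I" "\<lambda>j. A (h j)" "\<lambda>j. B (h j)"] hI AB(1,2) by auto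
qed

text \<open>One pair of whole spaces has ratio 1. This keeps logarithms nonnegative and rules out
  the product of 0 and infinity.\<close>

lemma guessing_gain_ge_1: "1 \<le> guessing_gain MX MY P"
  using guessing_gain_ge[of 1 "\<lambda>_. space MX" "\<lambda>_. space MY"] prob_space
  by (simp add: disjoint_family_on_def space_joint[symmetric])

lemma measure_rectangle_mono: "A \<in> sets MX \<Longrightarrow> B \<in> sets MY \<Longrightarrow> measure P (A \<times> B) \<le> measure P (A \<times> space MY)"
  by (intro finite_measure_mono) (auto dest: sets.sets_into_space simp: rectangle_joint)

text \<open>The integrals of g over disjoint B_j add up to at most its full integral. Domination is
  assumed only for the pairs in the sum, so the lemma also applies before g is known to be a leakage
  density.\<close>

lemma sum_ratio_le_nn_integral:
  fixes n :: nat
  assumes [measurable]: "g \<in> borel_measurable MY"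
    and B: "\<And>j. j < n \<Longrightarrow> B j \<in> sets MY" and dis: "disjoint_family_on B {..<n}"
    and le: "\<And>j. j < n \<Longrightarrow> ennreal (measure P (A j \<times> B j) / measure P (A j \<times> space MY)) \<le>
      (\<integral>\<^sup>+z. g (snd z) * indicator (B j) (snd z) \<partial>P)"
  shows "ennreal (\<Sum>j<n. measure P (A j \<times> B j) / measure P (A j \<times> space MY)) \<le> (\<integral>\<^sup>+z. g (snd z) \<partial>P)"
proof -
  have [measurable]: "B j \<in> sets MY" if "j \<in> {..<n}" for j
    using B that by simp
  have "ennreal (\<Sum>j<n. measure P (A j \<times> B j) / measure P (A j \<times> space MY)) =
      (\<Sum>j<n. ennreal (measure P (A j \<times> B j) / measure P (A j \<times> space MY)))"
    by (simp add: sum_ennreal)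
  also have "\<dots> \<le> (\<Sum>j<n. \<integral>\<^sup>+z. g (snd z) * indicator (B j) (snd z) \<partial>P)"
    using le by (intro sum_mono) auto
  also have "\<dots> = (\<integral>\<^sup>+z. (\<Sum>j<n. g (snd z) * indicator (B j) (snd z)) \<partial>P)"
    by (rule nn_integral_sum[symmetric]) measurable
  also have "\<dots> \<le> (\<integral>\<^sup>+z. g (snd z) \<partial>P)"
  proof (rule nn_integral_mono)
    fix z
    have "(\<Sum>j<n. indicator (B j) (snd z) :: ennreal) = indicator (\<Union>j<n. B j) (snd z)"
      by (rule indicator_UN_disjoint[OF finite_lessThan dis, symmetric])
    also have "\<dots> \<le> 1" by (simp split: split_indicator)
    finally show "(\<Sum>j<n. g (snd z) * indicator (B j) (snd z)) \<le> g (snd z)"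
      using mult_left_mono[of "\<Sum>j<n. indicator (B j) (snd z)" 1 "g (snd z)"]
      by (simp add: sum_distrib_left)
  qed
  finally show "ennreal (\<Sum>j<n. measure P (A j \<times> B j) / measure P (A j \<times> space MY)) \<le> (\<integral>\<^sup>+z. g (snd z) \<partial>P)" .
qed

text \<open>Weak duality: dividing the domination by P(X in A_j) bounds each ratio by the integral
  of g over B_j. For a null A_j the ratio is 0 by the convention on division.\<close>

lemma guessing_gain_le:
  assumes g: "leakage_density MX MY P g"
  shows "guessing_gain MX MY P \<le> (\<integral>\<^sup>+z. g (snd z) \<partial>P)"
  unfolding guessing_gain_def
proof (rule SUP_least, clarify)
  fix n :: nat and A B
  assume A: "A \<in> {..<n} \<rightarrow> sets MX" and B: "B \<in> {..<n} \<rightarrow> sets MY" and dis: "disjoint_family_on B {..<n}"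
  show "ennreal (\<Sum>j<n. measure P (A j \<times> B j) / measure P (A j \<times> space MY)) \<le> (\<integral>\<^sup>+z. g (snd z) \<partial>P)"
  proof (rule sum_ratio_le_nn_integral)
    show "g \<in> borel_measurable MY"
      using g by (simp add: leakage_density_def)
    fix j assume "j < n"
    then have j: "A j \<in> sets MX" "B j \<in> sets MY" using A B by auto
    let ?I = "\<integral>\<^sup>+z. g (snd z) * indicator (B j) (snd z) \<partial>P"
    have le: "ennreal (measure P (A j \<times> B j)) \<le> ennreal (measure P (A j \<times> space MY)) * ?I"
      using g j unfolding leakage_density_def emeasure_eq_measure by blast
    show "ennreal (measure P (A j \<times> B j) / measure P (A j \<times> space MY)) \<le> ?I"
    proof (cases "measure P (A j \<times> space MY) = 0")
      case False
      then have pos: "0 < measure P (A j \<times> space MY)" by (simp add: zero_less_measure_iff)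
      have "ennreal (measure P (A j \<times> B j) / measure P (A j \<times> space MY)) =
          ennreal (measure P (A j \<times> B j)) / ennreal (measure P (A j \<times> space MY))"
        using pos by (simp add: divide_ennreal)
      also have "\<dots> \<le> ennreal (measure P (A j \<times> space MY)) * ?I / ennreal (measure P (A j \<times> space MY))"
        by (rule divide_right_mono_ennreal[OF le])
      also have "\<dots> = ?I"
        using pos by (simp add: ennreal_mult_divide_eq mult.commute[of "ennreal _"])
      finally show ?thesis .
    qed simp
  qed (use B dis in auto)
qed

text \<open>A version of dP(Y in . | X in A) / dP_Y, characterised by its integrals. For a null A
  these are all 0, so the density then vanishes almost everywhere.\<close>

definition marginal_density :: "'b set \<Rightarrow> 'c \<Rightarrow> ennreal" where
  "marginal_density A = (SOME h. h \<in> borel_measurable MY \<and>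
    (\<forall>B\<in>sets MY. (\<integral>\<^sup>+z. h (snd z) * indicator B (snd z) \<partial>P) =
      ennreal (measure P (A \<times> B) / measure P (A \<times> space MY))))"

text \<open>Radon-Nikodym for the conditional law \<open>?N\<close> of Y given X in A. It is
  absolutely continuous with respect to P_Y because P(X in A, Y in B) is at most P(Y in B).\<close>

lemma marginal_density:
  assumes A: "A \<in> sets MX"
  shows measurable_marginal_density: "marginal_density A \<in> borel_measurable MY"
    and nn_integral_marginal_density: "B \<in> sets MY \<Longrightarrow>
      (\<integral>\<^sup>+z. marginal_density A (snd z) * indicator B (snd z) \<partial>P) =
        ennreal (measure P (A \<times> B) / measure P (A \<times> space MY))"
proof -
  let ?PY = "distr P MY snd" and ?c = "ennreal (1 / measure P (A \<times> space MY))"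
  let ?N = "distr (density P (\<lambda>z. ?c * indicator (A \<times> space MY) z)) MY snd"
  interpret PY: prob_space ?PY by (rule prob_space_distr) simp
  have [measurable]: "A \<times> space MY \<in> sets P" using A by (simp add: rectangle_joint)
  have N: "emeasure ?N B = ennreal (measure P (A \<times> B) / measure P (A \<times> space MY))"
    if B[measurable]: "B \<in> sets MY" for B
  proof -
    have eq: "snd -` B \<inter> space P \<inter> (A \<times> space MY) = A \<times> B"
      using sets.sets_into_space[OF A] sets.sets_into_space[OF B] by (auto simp: space_joint)
    have "emeasure ?N B = emeasure (density P (\<lambda>z. ?c * indicator (A \<times> space MY) z)) (snd -` B \<inter> space P)"
      by (subst emeasure_distr) (simp_all add: measurable_cong_sets[OF sets_density refl])
    also have "\<dots> = (\<integral>\<^sup>+z. ?c * indicator (A \<times> space MY) z * indicator (snd -` B \<inter> space P) z \<partial>P)"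
      by (subst emeasure_density) auto
    also have "\<dots> = (\<integral>\<^sup>+z. ?c * indicator (A \<times> B) z \<partial>P)"
      unfolding eq[symmetric] by (intro nn_integral_cong) (auto split: split_indicator)
    also have "\<dots> = ?c * emeasure P (A \<times> B)"
      using A B by (simp add: nn_integral_cmult_indicator rectangle_joint)
    also have "\<dots> = ennreal (measure P (A \<times> B) / measure P (A \<times> space MY))"
      by (simp add: emeasure_eq_measure ennreal_mult[symmetric])
    finally show ?thesis .
  qed
  have "absolutely_continuous ?PY ?N"
    unfolding absolutely_continuous_def
  proof
    fix B assume "B \<in> null_sets ?PY"
    then have B: "B \<in> sets MY" and "emeasure P (snd -` B \<inter> space P) = 0"
      by (auto simp: null_sets_def emeasure_distr)
    moreover have "emeasure P (A \<times> B) \<le> emeasure P (snd -` B \<inter> space P)"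
      using sets.sets_into_space[OF A] sets.sets_into_space[OF B] B
      by (intro emeasure_mono) (auto simp: space_joint)
    ultimately have "measure P (A \<times> B) = 0" by (simp add: measure_def)
    then show "B \<in> null_sets ?N" using B N[OF B] by (auto simp: null_sets_def)
  qed
  then obtain h where h: "h \<in> borel_measurable ?PY" "density ?PY h = ?N"
    using PY.Radon_Nikodym[of ?N] by auto
  have "\<exists>h. h \<in> borel_measurable MY \<and>
    (\<forall>B\<in>sets MY. (\<integral>\<^sup>+z. h (snd z) * indicator B (snd z) \<partial>P) =
      ennreal (measure P (A \<times> B) / measure P (A \<times> space MY)))"
  proof (intro exI[of _ h] conjI ballI)
    show hm[measurable]: "h \<in> borel_measurable MY" using h(1) by simp
    fix B assume B[measurable]: "B \<in> sets MY"
    show "(\<integral>\<^sup>+z. h (snd z) * indicator B (snd z) \<partial>P) =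
      ennreal (measure P (A \<times> B) / measure P (A \<times> space MY))"
      unfolding N[OF B, symmetric] h(2)[symmetric]
      by (subst emeasure_density) (auto simp: nn_integral_distr)
  qed
  note * = someI_ex[OF this, folded marginal_density_def]
  show "marginal_density A \<in> borel_measurable MY" using * by blast
  show "B \<in> sets MY \<Longrightarrow> (\<integral>\<^sup>+z. marginal_density A (snd z) * indicator B (snd z) \<partial>P) =
        ennreal (measure P (A \<times> B) / measure P (A \<times> space MY))" using * by blast
qed

text \<open>Split the values of Y according to which density attains the maximum. On each piece the
  integral is one conditional probability, and the pieces are disjoint, so the total is an
  admissible guessing sum.\<close>

lemma nn_integral_Max_marginal_density_le:
  fixes n :: nat
  assumes A: "\<And>j. j < n \<Longrightarrow> A j \<in> sets MX"
  shows "(\<integral>\<^sup>+z. (SUP j\<in>{..<n}. marginal_density (A j) (snd z)) \<partial>P) \<le> guessing_gain MX MY P"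
proof -
  define g where "g y = (SUP j\<in>{..<n}. marginal_density (A j) y)" for y
  have m[measurable]: "marginal_density (A j) \<in> borel_measurable MY" if "j < n" for j
    using A that by (intro measurable_marginal_density)
  have g[measurable]: "g \<in> borel_measurable MY"
    unfolding g_def using m by (intro borel_measurable_SUP) auto
  \<comment> \<open>The sets \<open>D j\<close> overlap where the maximum is tied;
    \<open>disjointed\<close> gives ties to the smallest index. They are empty for j >= n, so a
    sequence over all naturals does no harm.\<close>
  define D where "D j = {y \<in> space MY. j < n \<and> marginal_density (A j) y = g y}" for j
  define B where "B = disjointed D"
  have D: "D j \<in> sets MY" for j
  proof (cases "j < n")
    case True
    with m[OF True] show ?thesis unfolding D_def by simp
  qed (simp add: D_def)
  have B[measurable]: "B j \<in> sets MY" for j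
    unfolding B_def disjointed_def using D by auto
  have dis: "disjoint_family_on B {..<n}"
    unfolding B_def using disjoint_family_disjointed[of D] by (auto simp: disjoint_family_on_def)
  have BD: "B j \<subseteq> D j" for j unfolding B_def by (rule disjointed_subset)
  have cover: "(\<Union>j<n. B j) = (\<Union>j<n. D j)"
    using finite_UN_disjointed_eq[of D n] by (simp add: B_def atLeast0LessThan)
  have g_le: "g (snd z) \<le> (\<Sum>j<n. marginal_density (A j) (snd z) * indicator (B j) (snd z))"
    if z: "z \<in> space P" for z
  proof (cases "n = 0")
    case False
    then have "g (snd z) \<in> (\<lambda>j. marginal_density (A j) (snd z)) ` {..<n}"
      unfolding g_def by (subst Max_Sup[symmetric]) (auto intro!: Max_in)
    then have "snd z \<in> (\<Union>j<n. D j)"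
      using z by (force simp: D_def space_joint)
    then obtain j where j: "j < n" "snd z \<in> B j" using cover by auto
    then have "g (snd z) = marginal_density (A j) (snd z) * indicator (B j) (snd z)"
      using BD[of j] by (auto simp: D_def)
    also have "\<dots> \<le> (\<Sum>j<n. marginal_density (A j) (snd z) * indicator (B j) (snd z))"
      using j by (intro member_le_sum) auto
    finally show ?thesis .
  qed (simp add: g_def bot_ennreal)
  have "(\<integral>\<^sup>+z. g (snd z) \<partial>P) \<le> (\<integral>\<^sup>+z. (\<Sum>j<n. marginal_density (A j) (snd z) * indicator (B j) (snd z)) \<partial>P)"
    using g_le by (rule nn_integral_mono)
  also have "\<dots> = (\<Sum>j<n. \<integral>\<^sup>+z. marginal_density (A j) (snd z) * indicator (B j) (snd z) \<partial>P)"
    by (rule nn_integral_sum) (use m in measurable)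
  also have "\<dots> = (\<Sum>j<n. ennreal (measure P (A j \<times> B j) / measure P (A j \<times> space MY)))"
    using A B by (intro sum.cong refl nn_integral_marginal_density) auto
  also have "\<dots> = ennreal (\<Sum>j<n. measure P (A j \<times> B j) / measure P (A j \<times> space MY))"
    by (simp add: sum_ennreal)
  also have "\<dots> \<le> guessing_gain MX MY P"
    by (rule guessing_gain_ge[OF A B dis])
  finally show ?thesis by (simp add: g_def)
qed

text \<open>Monotone convergence over initial segments. The bound is the same for every sequence of
  events; this uniformity makes the maximality argument in \<open>ex_leakage_density\<close>
  work.\<close>

lemma nn_integral_SUP_marginal_density_le:
  assumes A: "\<And>j :: nat. A j \<in> sets MX"
  shows "(\<integral>\<^sup>+z. (SUP j. marginal_density (A j) (snd z)) \<partial>P) \<le> guessing_gain MX MY P"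
proof -
  have [measurable]: "marginal_density (A j) \<in> borel_measurable MY" for j
    using A by (rule measurable_marginal_density)
  have "(SUP j. marginal_density (A j) y) = (SUP n. SUP j\<in>{..<n}. marginal_density (A j) y)" for y
    by (rule antisym) (auto intro!: SUP_least SUP_upper intro: SUP_upper2[of "Suc _"] SUP_upper2)
  then have "(\<integral>\<^sup>+z. (SUP j. marginal_density (A j) (snd z)) \<partial>P) =
      (\<integral>\<^sup>+z. (SUP n. SUP j\<in>{..<n}. marginal_density (A j) (snd z)) \<partial>P)"
    by simp
  also have "\<dots> = (SUP n. \<integral>\<^sup>+z. (SUP j\<in>{..<n}. marginal_density (A j) (snd z)) \<partial>P)"
    by (rule nn_integral_monotone_convergence_SUP)
       (auto simp: incseq_def le_fun_def intro!: SUP_subset_mono)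
  also have "\<dots> \<le> guessing_gain MX MY P"
    using A by (intro SUP_least nn_integral_Max_marginal_density_le)
  finally show ?thesis .
qed

text \<open>Strong duality: g is an essential supremum of all conditional densities. It collects the
  countably many events of a maximising sequence of sums, so its integral equals the gain, and
  finiteness of the gain leaves no room for a density that exceeds g on a set of positive
  measure.\<close>

lemma ex_leakage_density:
  assumes fin: "guessing_gain MX MY P < \<top>"
  shows "\<exists>g. leakage_density MX MY P g \<and> (\<integral>\<^sup>+z. g (snd z) \<partial>P) \<le> guessing_gain MX MY P"
proof -
  let ?T = "{(n :: nat, A, B). A \<in> {..<n} \<rightarrow> sets MX \<and> B \<in> {..<n} \<rightarrow> sets MY \<and>
        disjoint_family_on B {..<n}}"
  let ?v = "\<lambda>(n, A, B). ennreal (\<Sum>j<n. measure P (A j \<times> B j) / measure P (A j \<times> space MY))"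
  have "(0, \<lambda>_. {}, \<lambda>_. {}) \<in> ?T" by (simp add: disjoint_family_on_def)
  then have "?T \<noteq> {}" by blast
  from ennreal_SUP_countable_SUP[OF this, of ?v] obtain f
    where f: "range f \<subseteq> ?v ` ?T" and sup: "guessing_gain MX MY P = (SUP m :: nat. f m)"
    unfolding guessing_gain_def by auto
  have "\<forall>m. \<exists>t. t \<in> T \<and> f m = v t" if "range f \<subseteq> v ` T" for v :: "'z \<Rightarrow> ennreal" and T
    using that by fast
  from choice[OF this[OF f]] obtain t where t: "\<And>m. t m \<in> ?T" "\<And>m. f m = ?v (t m)"
    by iprover
  define n where "n m = fst (t m)" for m
  define A where "A m = fst (snd (t m))" for m
  define B where "B m = snd (snd (t m))" for m
  have n: "A m j \<in> sets MX" "B m j \<in> sets MY" if "j < n m" for m j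
    using t(1)[of m] that by (auto simp: n_def A_def B_def)
  have dis: "disjoint_family_on (B m) {..<n m}" for m
    using t(1)[of m] by (auto simp: n_def B_def)
  have fm: "f m = ennreal (\<Sum>j<n m. measure P (A m j \<times> B m j) / measure P (A m j \<times> space MY))" for m
    using t(2)[of m] by (simp add: n_def A_def B_def split_beta)
  \<comment> \<open>All events used by the maximising sequence. \<open>space MX\<close> makes the
    set nonempty, as \<open>from_nat_into\<close> requires for an enumeration.\<close>
  define \<A> where "\<A> = insert (space MX) (\<Union>m. A m ` {..<n m})"
  define c where "c = from_nat_into \<A>"
  have c: "range c = \<A>"
    unfolding c_def by (rule range_from_nat_into) (auto simp: \<A>_def)
  have cX: "c j \<in> sets MX" for j
  proof -
    have "c j \<in> \<A>" unfolding c[symmetric] by (rule rangeI)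
    then show ?thesis using n(1) by (auto simp: \<A>_def)
  qed
  define g where "g y = (SUP j. marginal_density (c j) y)" for y
  have mc[measurable]: "marginal_density (c j) \<in> borel_measurable MY" for j
    using cX by (rule measurable_marginal_density)
  have g[measurable]: "g \<in> borel_measurable MY"
    unfolding g_def by measurable
  have le: "(\<integral>\<^sup>+z. g (snd z) \<partial>P) \<le> guessing_gain MX MY P"
    unfolding g_def using cX by (rule nn_integral_SUP_marginal_density_le)
  \<comment> \<open>Every sum of the sequence uses only events enumerated by c, whose densities lie
    below g.\<close>
  have ge: "guessing_gain MX MY P \<le> (\<integral>\<^sup>+z. g (snd z) \<partial>P)"
    unfolding sup
  proof (rule SUP_least)
    fix m
    show "f m \<le> (\<integral>\<^sup>+z. g (snd z) \<partial>P)"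
      unfolding fm
    proof (rule sum_ratio_le_nn_integral[OF g n(2) dis])
      fix j assume j: "j < n m"
      then have "A m j \<in> \<A>" by (auto simp: \<A>_def)
      then obtain i where i: "A m j = c i" using c by force
      show "ennreal (measure P (A m j \<times> B m j) / measure P (A m j \<times> space MY)) \<le>
          (\<integral>\<^sup>+z. g (snd z) * indicator (B m j) (snd z) \<partial>P)"
        unfolding nn_integral_marginal_density[OF n[OF j], symmetric]
        by (intro nn_integral_mono mult_right_mono) (auto simp: i g_def intro: SUP_upper)
    qed auto
  qed
  have ae: "AE z in P. marginal_density A (snd z) \<le> g (snd z)" if A: "A \<in> sets MX" for A
  proof -
    have [measurable]: "marginal_density A \<in> borel_measurable MY"
      using A by (rule measurable_marginal_density)
    \<comment> \<open>\<open>case_nat A c\<close> puts A in front of the sequence, and the uniform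
      bound applies again. Thus the integral of \<open>?h\<close> is at most that of g and finite,
      although \<open>?h\<close> >= g pointwise; hence they agree almost everywhere.\<close>
    let ?h = "\<lambda>z. sup (marginal_density A (snd z)) (g (snd z))"
    have "sup (marginal_density A y) (g y) = (SUP j. marginal_density (case_nat A c j) y)" for y
    proof (rule antisym)
      show "sup (marginal_density A y) (g y) \<le> (SUP j. marginal_density (case_nat A c j) y)"
        unfolding g_def
        by (intro sup_least SUP_least) (auto intro: SUP_upper2[of 0] SUP_upper2[of "Suc _"])
      show "(SUP j. marginal_density (case_nat A c j) y) \<le> sup (marginal_density A y) (g y)"
        unfolding g_def by (intro SUP_least) (auto split: nat.split intro: le_supI2[OF SUP_upper[OF UNIV_I]])
    qed
    then have "(\<integral>\<^sup>+z. ?h z \<partial>P) \<le> guessing_gain MX MY P"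
      using nn_integral_SUP_marginal_density_le[of "case_nat A c"] A cX by (simp split: nat.split)
    then have hle: "(\<integral>\<^sup>+z. ?h z \<partial>P) \<le> (\<integral>\<^sup>+z. g (snd z) \<partial>P)" using ge by order
    have "(\<integral>\<^sup>+z. ?h z - g (snd z) \<partial>P) = (\<integral>\<^sup>+z. ?h z \<partial>P) - (\<integral>\<^sup>+z. g (snd z) \<partial>P)"
      using le fin by (intro nn_integral_diff) auto
    also have "\<dots> = 0" using hle le fin by (intro diff_eq_0_ennreal) auto
    finally have "AE z in P. ?h z - g (snd z) = 0"
      by (subst (asm) nn_integral_0_iff_AE) auto
    then show ?thesis
    proof eventually_elim
      case (elim z)
      then have "?h z \<le> g (snd z)" by (rule ennreal_minus_eq_0)
      then show ?case by simp
    qed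
  qed
  have "leakage_density MX MY P g"
    unfolding leakage_density_def
  proof (intro conjI ballI g)
    fix A B assume A: "A \<in> sets MX" and B: "B \<in> sets MY"
    have "emeasure P (A \<times> B) = emeasure P (A \<times> space MY) * ennreal (measure P (A \<times> B) / measure P (A \<times> space MY))"
      using measure_rectangle_mono[OF A B] measure_nonneg[of P "A \<times> B"]
      by (cases "measure P (A \<times> space MY) = 0") (auto simp: emeasure_eq_measure ennreal_mult[symmetric])
    also have "\<dots> \<le> emeasure P (A \<times> space MY) * (\<integral>\<^sup>+z. g (snd z) * indicator B (snd z) \<partial>P)"
      unfolding nn_integral_marginal_density[OF A B, symmetric]
      using ae[OF A] by (intro mult_left_mono nn_integral_mono_AE) (auto elim!: eventually_mono intro: mult_right_mono)
    finally show "emeasure P (A \<times> B) \<le> emeasure P (A \<times> space MY) * (\<integral>\<^sup>+z. g (snd z) * indicator B (snd z) \<partial>P)" .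
  qed
  with le show ?thesis by blast
qed

end

section \<open>Guessing laws\<close>

context joint_law
begin

text \<open>One use of \<open>nn_integral_subalgebra_le\<close> for each half of the chain. The
  weight P(U = a | X) carries the domination from events of X to the event U = a; the weight P(V = a
  | Y) then carries it from events of Y to the event V = a. The guess may be randomised.\<close>

lemma guessing_success_le:
  assumes g: "leakage_density MX MY P g" and fin: "finite A" and Q: "Q \<in> guessing_laws MX MY P A"
  shows "emeasure Q {(u, x, y, v) \<in> space Q. u = v} \<le>
    ennreal (Max ((\<lambda>a. measure Q {(u, x, y, v) \<in> space Q. u = a}) ` A)) * (\<integral>\<^sup>+z. g (snd z) \<partial>P)"
proof -
  let ?N = "count_space A"
  define U :: "nat \<times> 'b \<times> 'c \<times> nat \<Rightarrow> nat" where "U = (\<lambda>(u, x, y, v). u)"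
  define X :: "nat \<times> 'b \<times> 'c \<times> nat \<Rightarrow> 'b" where "X = (\<lambda>(u, x, y, v). x)"
  define Y :: "nat \<times> 'b \<times> 'c \<times> nat \<Rightarrow> 'c" where "Y = (\<lambda>(u, x, y, v). y)"
  define V :: "nat \<times> 'b \<times> 'c \<times> nat \<Rightarrow> nat" where "V = (\<lambda>(u, x, y, v). v)"
  have "prob_space Q" using Q by (simp add: guessing_laws_def)
  then interpret Q: prob_space Q .
  have law: "distr Q (MX \<Otimes>\<^sub>M MY) (\<lambda>\<omega>. (X \<omega>, Y \<omega>)) = P"
    using Q by (simp add: guessing_laws_def X_def Y_def split_beta')
  have "Q.markov_chain4 ?N MX MY ?N U X Y V"
    using Q by (simp add: guessing_laws_def U_def X_def Y_def V_def)
  then have mc1: "Q.markov_chain3 ?N MX (MY \<Otimes>\<^sub>M ?N) U X (\<lambda>\<omega>. (Y \<omega>, V \<omega>))"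
    and mc2: "Q.markov_chain3 (?N \<Otimes>\<^sub>M MX) MY ?N (\<lambda>\<omega>. (U \<omega>, X \<omega>)) Y V"
    by (auto simp: Q.markov_chain4_def)
  have [measurable]: "U \<in> measurable Q ?N" "X \<in> measurable Q MX" "Y \<in> measurable Q MY" "V \<in> measurable Q ?N"
    using mc1 mc2 by (auto simp: Q.markov_chain3_def)
  have [measurable]: "g \<in> borel_measurable MY"
    using g by (simp add: leakage_density_def)
  have UA: "U \<omega> \<in> A" and VA: "V \<omega> \<in> A" if "\<omega> \<in> space Q" for \<omega>
    using that measurable_space[of U Q ?N \<omega>] measurable_space[of V Q ?N \<omega>] by auto
  have XS: "X \<omega> \<in> space MX" and YS: "Y \<omega> \<in> space MY" if "\<omega> \<in> space Q" for \<omega>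
    using that measurable_space[of X Q MX \<omega>] measurable_space[of Y Q MY \<omega>] by auto
  have intP: "(\<integral>\<^sup>+z. h z \<partial>P) = (\<integral>\<^sup>+\<omega>. h (X \<omega>, Y \<omega>) \<partial>Q)" if [measurable]: "h \<in> borel_measurable (MX \<Otimes>\<^sub>M MY)" for h
    unfolding law[symmetric] by (rule nn_integral_distr) measurable
  have emP: "emeasure P (C \<times> B) = emeasure Q {\<omega> \<in> space Q. X \<omega> \<in> C \<and> Y \<omega> \<in> B}"
    if [measurable]: "C \<in> sets MX" "B \<in> sets MY" for B C
    unfolding law[symmetric] by (subst emeasure_distr) (auto intro!: arg_cong[where f="emeasure Q"])
  let ?FX = "vimage_algebra (space Q) X MX" and ?FY = "vimage_algebra (space Q) Y MY"
  interpret FX: finite_measure_subalgebra Q ?FX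
    by unfold_locales (rule subalgebra_vimage_algebra, simp)
  interpret FY: finite_measure_subalgebra Q ?FY
    by unfold_locales (rule subalgebra_vimage_algebra, simp)
  define m where "m a = emeasure Q {\<omega> \<in> space Q. U \<omega> = a}" for a
  \<comment> \<open>U = a behaves like an event of X: the domination holds on every event of X,
    hence also under the weight P(U = a | X).\<close>
  have past: "emeasure Q {\<omega> \<in> space Q. Y \<omega> \<in> B \<and> U \<omega> = a} \<le> m a * (\<integral>\<^sup>+\<omega>. g (Y \<omega>) * indicator B (Y \<omega>) \<partial>Q)"
    if B[measurable]: "B \<in> sets MY" and a: "a \<in> A" for B a
  proof -
    let ?G = "\<integral>\<^sup>+\<omega>. g (Y \<omega>) * indicator B (Y \<omega>) \<partial>Q"
    let ?p = "real_cond_exp Q ?FX (indicator {\<omega> \<in> space Q. U \<omega> \<in> {a}})"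
    have a'[measurable]: "{a} \<in> sets ?N" using a by simp
    \<comment> \<open>The first half of the chain concerns the pair (Y, V), so V is carried along
      with its full range A.\<close>
    have "emeasure Q {\<omega> \<in> space Q. Y \<omega> \<in> B \<and> U \<omega> = a} =
        emeasure Q {\<omega> \<in> space Q. (Y \<omega>, V \<omega>) \<in> B \<times> A \<and> U \<omega> \<in> {a}}"
      using VA by (intro arg_cong[where f="emeasure Q"]) auto
    also have "\<dots> = (\<integral>\<^sup>+\<omega>. indicator {\<omega> \<in> space Q. (Y \<omega>, V \<omega>) \<in> B \<times> A} \<omega> * ennreal (?p \<omega>) \<partial>Q)"
      by (rule Q.markov_chain3_nn_integral[OF Q.markov_chain3_commute[OF mc1]]) (auto simp: a)
    also have "\<dots> = (\<integral>\<^sup>+\<omega>. indicator {\<omega> \<in> space Q. Y \<omega> \<in> B} \<omega> * ennreal (?p \<omega>) \<partial>Q)"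
      using VA by (intro nn_integral_cong) (auto split: split_indicator)
    also have "\<dots> \<le> (\<integral>\<^sup>+\<omega>. ?G * ennreal (?p \<omega>) \<partial>Q)"
    proof (rule nn_integral_subalgebra_le[OF FX.subalg])
      fix E assume "E \<in> sets ?FX"
      then obtain C where C[measurable]: "C \<in> sets MX" and E: "E = X -` C \<inter> space Q"
        by (auto simp: sets_vimage_algebra_measurable)
      have "(\<integral>\<^sup>+\<omega>. indicator {\<omega> \<in> space Q. Y \<omega> \<in> B} \<omega> * indicator E \<omega> \<partial>Q) = emeasure P (C \<times> B)"
        unfolding emP[OF C B] E
        by (subst nn_integral_indicator_times) (auto intro!: arg_cong[where f="emeasure Q"])
      also have "\<dots> \<le> emeasure P (C \<times> space MY) * (\<integral>\<^sup>+z. g (snd z) * indicator B (snd z) \<partial>P)"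
        using g B C by (simp add: leakage_density_def)
      also have "emeasure P (C \<times> space MY) = emeasure Q E"
        unfolding emP[OF C sets.top] E
        by (intro arg_cong[where f="emeasure Q"]) (auto simp: YS)
      also have "(\<integral>\<^sup>+z. g (snd z) * indicator B (snd z) \<partial>P) = ?G"
        by (subst intP) auto
      also have "emeasure Q E * ?G = (\<integral>\<^sup>+\<omega>. ?G * indicator E \<omega> \<partial>Q)"
        unfolding E by (subst nn_integral_cmult_indicator) (auto simp: mult.commute)
      finally show "(\<integral>\<^sup>+\<omega>. indicator {\<omega> \<in> space Q. Y \<omega> \<in> B} \<omega> * indicator E \<omega> \<partial>Q) \<le> (\<integral>\<^sup>+\<omega>. ?G * indicator E \<omega> \<partial>Q)" .
    qed auto
    also have "\<dots> = ?G * (\<integral>\<^sup>+\<omega>. ennreal (?p \<omega>) * 1 \<partial>Q)"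
      by (simp add: nn_integral_cmult)
    also have "(\<integral>\<^sup>+\<omega>. ennreal (?p \<omega>) * 1 \<partial>Q) = (\<integral>\<^sup>+\<omega>. indicator {\<omega> \<in> space Q. U \<omega> \<in> {a}} \<omega> * 1 \<partial>Q)"
      by (rule FX.nn_integral_real_cond_exp_indicator) auto
    also have "\<dots> = m a"
      by (simp add: m_def)
    finally show ?thesis by (simp add: mult.commute)
  qed
  \<comment> \<open>Now Y is the present: \<open>past\<close> holds for every B, hence also under
    the weight P(V = a | Y), which is a function of Y.\<close>
  have hit: "emeasure Q {\<omega> \<in> space Q. U \<omega> = a \<and> V \<omega> = a} \<le>
      m a * (\<integral>\<^sup>+\<omega>. g (Y \<omega>) * indicator {\<omega> \<in> space Q. V \<omega> = a} \<omega> \<partial>Q)"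
    if a: "a \<in> A" for a
  proof -
    let ?q = "real_cond_exp Q ?FY (indicator {\<omega> \<in> space Q. V \<omega> \<in> {a}})"
    have a'[measurable]: "{a} \<in> sets ?N" using a by simp
    have gF: "(\<lambda>\<omega>. g (Y \<omega>)) \<in> borel_measurable ?FY"
      by (rule measurable_comp_vimage_algebra) auto
    have "emeasure Q {\<omega> \<in> space Q. U \<omega> = a \<and> V \<omega> = a} =
        emeasure Q {\<omega> \<in> space Q. (U \<omega>, X \<omega>) \<in> {a} \<times> space MX \<and> V \<omega> \<in> {a}}"
      by (intro arg_cong[where f="emeasure Q"]) (auto simp: XS)
    also have "\<dots> = (\<integral>\<^sup>+\<omega>. indicator {\<omega> \<in> space Q. (U \<omega>, X \<omega>) \<in> {a} \<times> space MX} \<omega> * ennreal (?q \<omega>) \<partial>Q)"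
      by (rule Q.markov_chain3_nn_integral[OF mc2]) (auto simp: a)
    also have "\<dots> \<le> (\<integral>\<^sup>+\<omega>. (m a * g (Y \<omega>)) * ennreal (?q \<omega>) \<partial>Q)"
    proof (rule nn_integral_subalgebra_le[OF FY.subalg])
      fix E assume "E \<in> sets ?FY"
      then obtain B where B[measurable]: "B \<in> sets MY" and E: "E = Y -` B \<inter> space Q"
        by (auto simp: sets_vimage_algebra_measurable)
      have "(\<integral>\<^sup>+\<omega>. indicator {\<omega> \<in> space Q. (U \<omega>, X \<omega>) \<in> {a} \<times> space MX} \<omega> * indicator E \<omega> \<partial>Q)
          = emeasure Q {\<omega> \<in> space Q. Y \<omega> \<in> B \<and> U \<omega> = a}"
        unfolding E
        by (subst nn_integral_indicator_times)
          (auto intro!: arg_cong[where f="emeasure Q"] simp: XS a)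
      also have "\<dots> \<le> m a * (\<integral>\<^sup>+\<omega>. g (Y \<omega>) * indicator B (Y \<omega>) \<partial>Q)"
        by (rule past[OF B a])
      also have "\<dots> = (\<integral>\<^sup>+\<omega>. m a * (g (Y \<omega>) * indicator B (Y \<omega>)) \<partial>Q)"
        by (rule nn_integral_cmult[symmetric]) measurable
      also have "\<dots> = (\<integral>\<^sup>+\<omega>. m a * g (Y \<omega>) * indicator E \<omega> \<partial>Q)"
        unfolding E by (intro nn_integral_cong) (auto split: split_indicator)
      finally show "(\<integral>\<^sup>+\<omega>. indicator {\<omega> \<in> space Q. (U \<omega>, X \<omega>) \<in> {a} \<times> space MX} \<omega> * indicator E \<omega> \<partial>Q)
          \<le> (\<integral>\<^sup>+\<omega>. m a * g (Y \<omega>) * indicator E \<omega> \<partial>Q)" .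
    qed auto
    also have "\<dots> = m a * (\<integral>\<^sup>+\<omega>. ennreal (?q \<omega>) * g (Y \<omega>) \<partial>Q)"
      by (subst nn_integral_cmult[symmetric]) (auto simp: mult_ac)
    also have "(\<integral>\<^sup>+\<omega>. ennreal (?q \<omega>) * g (Y \<omega>) \<partial>Q) =
        (\<integral>\<^sup>+\<omega>. indicator {\<omega> \<in> space Q. V \<omega> \<in> {a}} \<omega> * g (Y \<omega>) \<partial>Q)"
      by (rule FY.nn_integral_real_cond_exp_indicator[OF _ gF]) auto
    finally show ?thesis by (simp add: mult.commute)
  qed
  let ?M = "Max ((\<lambda>a. measure Q {(u, x, y, v) \<in> space Q. u = a}) ` A)"
  have m_le: "m a \<le> ennreal ?M" if "a \<in> A" for a
  proof -
    have "m a = ennreal (measure Q {(u, x, y, v) \<in> space Q. u = a})"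
      unfolding m_def Q.emeasure_eq_measure
      by (intro arg_cong[where f="\<lambda>S. ennreal (measure Q S)"]) (auto simp: U_def)
    also have "\<dots> \<le> ennreal ?M"
      using that fin by (intro ennreal_leI Max_ge) auto
    finally show ?thesis .
  qed
  have sing[measurable]: "{\<omega> \<in> space Q. V \<omega> = a} \<in> sets Q" "{\<omega> \<in> space Q. U \<omega> = a \<and> V \<omega> = a} \<in> sets Q"
    if "a \<in> A" for a
  proof -
    have a'[measurable]: "{a} \<in> sets ?N" using that by simp
    have "{\<omega> \<in> space Q. V \<omega> \<in> {a}} \<in> sets Q" "{\<omega> \<in> space Q. U \<omega> \<in> {a} \<and> V \<omega> \<in> {a}} \<in> sets Q"
      by measurable
    then show "{\<omega> \<in> space Q. V \<omega> = a} \<in> sets Q" "{\<omega> \<in> space Q. U \<omega> = a \<and> V \<omega> = a} \<in> sets Q"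
      by simp_all
  qed
  have "{(u, x, y, v) \<in> space Q. u = v} = (\<Union>a\<in>A. {\<omega> \<in> space Q. U \<omega> = a \<and> V \<omega> = a})"
    using UA by (auto simp: U_def V_def split_beta')
  then have "emeasure Q {(u, x, y, v) \<in> space Q. u = v} =
      (\<Sum>a\<in>A. emeasure Q {\<omega> \<in> space Q. U \<omega> = a \<and> V \<omega> = a})"
    using sing fin by (simp only:) (intro sum_emeasure[symmetric], auto simp: disjoint_family_on_def)
  also have "\<dots> \<le> (\<Sum>a\<in>A. ennreal ?M * (\<integral>\<^sup>+\<omega>. g (Y \<omega>) * indicator {\<omega> \<in> space Q. V \<omega> = a} \<omega> \<partial>Q))"
    by (intro sum_mono order_trans[OF hit] mult_right_mono m_le) auto
  also have "\<dots> = ennreal ?M * (\<integral>\<^sup>+\<omega>. (\<Sum>a\<in>A. g (Y \<omega>) * indicator {\<omega> \<in> space Q. V \<omega> = a} \<omega>) \<partial>Q)"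
    by (subst nn_integral_sum) (auto simp: sum_distrib_left)
  \<comment> \<open>The guess always lies in A, so the events V = a partition the space and g is
    counted exactly once.\<close>
  also have "(\<integral>\<^sup>+\<omega>. (\<Sum>a\<in>A. g (Y \<omega>) * indicator {\<omega> \<in> space Q. V \<omega> = a} \<omega>) \<partial>Q) = (\<integral>\<^sup>+\<omega>. g (Y \<omega>) \<partial>Q)"
  proof (rule nn_integral_cong)
    fix \<omega> assume \<omega>: "\<omega> \<in> space Q"
    have "(\<Sum>a\<in>A. g (Y \<omega>) * indicator {\<omega> \<in> space Q. V \<omega> = a} \<omega>) = (\<Sum>a\<in>A. if V \<omega> = a then g (Y \<omega>) else 0)"
      using \<omega> by (intro sum.cong) auto
    then show "(\<Sum>a\<in>A. g (Y \<omega>) * indicator {\<omega> \<in> space Q. V \<omega> = a} \<omega>) = g (Y \<omega>)"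
      using fin VA[OF \<omega>] by simp
  qed
  also have "\<dots> = (\<integral>\<^sup>+z. g (snd z) \<partial>P)"
    by (subst intP) auto
  finally show ?thesis .
qed

text \<open>Given X = x, the letter U is drawn from p(., x) without regard to Y, and the guess is
  v(Y). The conclusion records the two quantities of the leakage quotient: the letter masses and the
  probability of success.\<close>

lemma ex_guessing_law:
  fixes p :: "nat \<Rightarrow> 'b \<Rightarrow> real" and v :: "'c \<Rightarrow> nat"
  assumes fin: "finite A"
    and p[measurable]: "\<And>u. u \<in> A \<Longrightarrow> p u \<in> borel_measurable MX"
    and p_pos: "\<And>u x. u \<in> A \<Longrightarrow> 0 \<le> p u x" and p_sum: "\<And>x. (\<Sum>u\<in>A. p u x) = 1"
    and v[measurable]: "v \<in> measurable MY (count_space A)"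
  shows "\<exists>Q\<in>guessing_laws MX MY P A.
    (\<forall>a\<in>A. emeasure Q {(u, x, y, w) \<in> space Q. u = a} = (\<integral>\<^sup>+z. ennreal (p a (fst z)) \<partial>P)) \<and>
    emeasure Q {(u, x, y, w) \<in> space Q. u = w} = (\<integral>\<^sup>+z. ennreal (p (v (snd z)) (fst z)) \<partial>P)"
proof -
  let ?N = "count_space A"
  let ?T = "?N \<Otimes>\<^sub>M MX \<Otimes>\<^sub>M MY \<Otimes>\<^sub>M ?N"
  define U :: "nat \<times> 'b \<times> 'c \<times> nat \<Rightarrow> nat" where "U = (\<lambda>(u, x, y, v). u)"
  define X :: "nat \<times> 'b \<times> 'c \<times> nat \<Rightarrow> 'b" where "X = (\<lambda>(u, x, y, v). x)"
  define Y :: "nat \<times> 'b \<times> 'c \<times> nat \<Rightarrow> 'c" where "Y = (\<lambda>(u, x, y, v). y)"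
  define V :: "nat \<times> 'b \<times> 'c \<times> nat \<Rightarrow> nat" where "V = (\<lambda>(u, x, y, v). v)"
  define \<phi> where "\<phi> u z = (u, fst z, snd z, v (snd z))" for u :: nat and z :: "'b \<times> 'c"
  define W where "W = density (?N \<Otimes>\<^sub>M P) (\<lambda>(u, z). ennreal (p u (fst z)))"
  define Q where "Q = distr W ?T (\<lambda>(u, z). \<phi> u z)"
  have m1[measurable]: "(\<lambda>(u, z). ennreal (p u (fst z))) \<in> borel_measurable (?N \<Otimes>\<^sub>M P)"
    using fin by (intro measurable_pair_measure_countable1) (auto intro: countable_finite)
  have m2[measurable]: "(\<lambda>(u, z). \<phi> u z) \<in> measurable (?N \<Otimes>\<^sub>M P) ?T"
    unfolding \<phi>_def split_beta' by measurable
  have m3[measurable]: "(\<lambda>(u, z). \<phi> u z) \<in> measurable W ?T"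
    unfolding W_def by (simp add: measurable_cong_sets[OF sets_density refl])
  have sets_Q[measurable_cong]: "sets Q = sets ?T" by (simp add: Q_def)
  have space_Q: "space Q = A \<times> space MX \<times> space MY \<times> A"
    by (simp add: Q_def space_pair_measure)
  have \<phi>Q: "\<phi> u z \<in> space Q" if "u \<in> A" "z \<in> space P" for u z
    using that measurable_space[OF v, of "snd z"] by (auto simp: \<phi>_def space_Q space_joint)
  have \<phi>_proj[simp]: "U (\<phi> u z) = u" "X (\<phi> u z) = fst z" "Y (\<phi> u z) = snd z" "V (\<phi> u z) = v (snd z)" for u z
    by (simp_all add: \<phi>_def U_def X_def Y_def V_def)
  have m4[measurable]: "U \<in> measurable Q ?N" "X \<in> measurable Q MX" "Y \<in> measurable Q MY" "V \<in> measurable Q ?N"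
    unfolding U_def X_def Y_def V_def split_beta' by measurable
  \<comment> \<open>The later computations under Q reduce to this finite sum of integrals over
    P.\<close>
  have integral_Q: "(\<integral>\<^sup>+\<omega>. h \<omega> \<partial>Q) = (\<Sum>u\<in>A. \<integral>\<^sup>+z. ennreal (p u (fst z)) * h (\<phi> u z) \<partial>P)"
    if [measurable]: "h \<in> borel_measurable Q" for h
  proof -
    have h[measurable]: "h \<in> borel_measurable ?T" using that by simp
    have "(\<integral>\<^sup>+\<omega>. h \<omega> \<partial>Q) = (\<integral>\<^sup>+s. h (case s of (u, z) \<Rightarrow> \<phi> u z) \<partial>W)"
      unfolding Q_def by (rule nn_integral_distr) measurable
    also have "\<dots> = (\<integral>\<^sup>+s. (case s of (u, z) \<Rightarrow> ennreal (p u (fst z))) * h (case s of (u, z) \<Rightarrow> \<phi> u z) \<partial>(?N \<Otimes>\<^sub>M P))"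
      unfolding W_def by (rule nn_integral_density) measurable
    also have "\<dots> = (\<integral>\<^sup>+u. \<integral>\<^sup>+z. ennreal (p u (fst z)) * h (\<phi> u z) \<partial>P \<partial>?N)"
      by (subst nn_integral_fst[symmetric]) auto
    also have "\<dots> = (\<Sum>u\<in>A. \<integral>\<^sup>+z. ennreal (p u (fst z)) * h (\<phi> u z) \<partial>P)"
      using fin by (rule nn_integral_count_space_finite)
    finally show ?thesis .
  qed
  \<comment> \<open>Summing out the letter removes the weight, since p sums to 1. This gives total
    mass 1 and the law of (X, Y).\<close>
  have marginal: "(\<Sum>u\<in>A. \<integral>\<^sup>+z. ennreal (p u (fst z)) * f z \<partial>P) = (\<integral>\<^sup>+z. f z \<partial>P)"
    if [measurable]: "f \<in> borel_measurable P" for f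
  proof -
    have "(\<Sum>u\<in>A. \<integral>\<^sup>+z. ennreal (p u (fst z)) * f z \<partial>P) = (\<integral>\<^sup>+z. (\<Sum>u\<in>A. ennreal (p u (fst z)) * f z) \<partial>P)"
      by (rule nn_integral_sum[symmetric]) measurable
    also have "\<dots> = (\<integral>\<^sup>+z. f z \<partial>P)"
      by (simp add: sum_distrib_right[symmetric] sum_ennreal p_pos p_sum)
    finally show ?thesis .
  qed
  have emeasure_Q: "emeasure Q {\<omega> \<in> space Q. R \<omega>} =
      (\<Sum>u\<in>A. \<integral>\<^sup>+z. ennreal (p u (fst z)) * indicator {z \<in> space P. R (\<phi> u z)} z \<partial>P)"
    if [measurable]: "{\<omega> \<in> space Q. R \<omega>} \<in> sets Q" for R
  proof -
    have "emeasure Q {\<omega> \<in> space Q. R \<omega>} = (\<integral>\<^sup>+\<omega>. indicator {\<omega> \<in> space Q. R \<omega>} \<omega> \<partial>Q)"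
      by simp
    also have "\<dots> = (\<Sum>u\<in>A. \<integral>\<^sup>+z. ennreal (p u (fst z)) * indicator {\<omega> \<in> space Q. R \<omega>} (\<phi> u z) \<partial>P)"
      by (rule integral_Q) measurable
    also have "\<dots> = (\<Sum>u\<in>A. \<integral>\<^sup>+z. ennreal (p u (fst z)) * indicator {z \<in> space P. R (\<phi> u z)} z \<partial>P)"
      using \<phi>Q by (intro sum.cong nn_integral_cong) (auto split: split_indicator)
    finally show ?thesis .
  qed
  have "emeasure Q (space Q) = 1"
    using emeasure_Q[of "\<lambda>_. True"] marginal[of "\<lambda>_. 1"] emeasure_space_1
    by (simp cong: nn_integral_cong)
  then have prob_Q: "prob_space Q" by (rule prob_spaceI)
  interpret Q: prob_space Q by (rule prob_Q)
  have law: "distr Q (MX \<Otimes>\<^sub>M MY) (\<lambda>\<omega>. (X \<omega>, Y \<omega>)) = P"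
  proof (rule measure_eqI)
    fix E assume "E \<in> sets (distr Q (MX \<Otimes>\<^sub>M MY) (\<lambda>\<omega>. (X \<omega>, Y \<omega>)))"
    then have E[measurable]: "E \<in> sets (MX \<Otimes>\<^sub>M MY)" by simp
    have "emeasure (distr Q (MX \<Otimes>\<^sub>M MY) (\<lambda>\<omega>. (X \<omega>, Y \<omega>))) E = emeasure Q {\<omega> \<in> space Q. (X \<omega>, Y \<omega>) \<in> E}"
      by (subst emeasure_distr) (auto intro!: arg_cong[where f="emeasure Q"])
    also have "\<dots> = (\<Sum>u\<in>A. \<integral>\<^sup>+z. ennreal (p u (fst z)) * indicator {z \<in> space P. z \<in> E} z \<partial>P)"
      by (subst emeasure_Q) auto
    also have "\<dots> = emeasure P {z \<in> space P. z \<in> E}"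
      by (subst marginal) auto
    also have "{z \<in> space P. z \<in> E} = E"
      using sets.sets_into_space[of E P] E by (auto simp: sets_joint)
    finally show "emeasure (distr Q (MX \<Otimes>\<^sub>M MY) (\<lambda>\<omega>. (X \<omega>, Y \<omega>))) E = emeasure P E" .
  qed (simp add: sets_joint)
  \<comment> \<open>\<open>markov_chain3I\<close> needs a kernel for the last variable, and the
    kernel at hand is that of U given X: r(x) is the sum of p(u, x) over u in C. The chain is
    therefore proved backwards and then reversed.\<close>
  have "Q.markov_chain3 (MY \<Otimes>\<^sub>M ?N) MX ?N (\<lambda>\<omega>. (Y \<omega>, V \<omega>)) X U"
  proof (rule Q.markov_chain3I)
    fix C assume "C \<in> sets ?N"
    then have C: "C \<subseteq> A" by simp
    have C'[measurable]: "C \<in> sets ?N" using C by simp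
    define r where "r x = (\<Sum>u\<in>C. p u x)" for x
    have r[measurable]: "r \<in> borel_measurable MX"
      unfolding r_def using C p by (intro borel_measurable_sum) auto
    show "\<exists>r\<in>borel_measurable MX. (\<forall>y. 0 \<le> r y \<and> r y \<le> 1) \<and> (\<forall>D\<in>sets (MY \<Otimes>\<^sub>M ?N). \<forall>B\<in>sets MX.
      emeasure Q {\<omega> \<in> space Q. (Y \<omega>, V \<omega>) \<in> D \<and> X \<omega> \<in> B \<and> U \<omega> \<in> C} =
      (\<integral>\<^sup>+\<omega>. ennreal (r (X \<omega>)) * indicator {\<omega> \<in> space Q. (Y \<omega>, V \<omega>) \<in> D \<and> X \<omega> \<in> B} \<omega> \<partial>Q))"
    proof (intro bexI[of _ r] conjI allI ballI r)
      fix x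
      show "0 \<le> r x" unfolding r_def using C p_pos by (intro sum_nonneg) auto
      show "r x \<le> 1" unfolding r_def p_sum[of x, symmetric] using C fin p_pos by (intro sum_mono2) auto
    next
      fix D B assume [measurable]: "D \<in> sets (MY \<Otimes>\<^sub>M ?N)" "B \<in> sets MX"
      let ?R = "{z \<in> space P. (snd z, v (snd z)) \<in> D \<and> fst z \<in> B}"
      have "emeasure Q {\<omega> \<in> space Q. (Y \<omega>, V \<omega>) \<in> D \<and> X \<omega> \<in> B \<and> U \<omega> \<in> C} =
         (\<Sum>u\<in>A. \<integral>\<^sup>+z. ennreal (p u (fst z)) * indicator {z \<in> space P. (snd z, v (snd z)) \<in> D \<and> fst z \<in> B \<and> u \<in> C} z \<partial>P)"
        by (subst emeasure_Q) auto
      also have "\<dots> = (\<Sum>u\<in>C. \<integral>\<^sup>+z. ennreal (p u (fst z)) * indicator {z \<in> space P. (snd z, v (snd z)) \<in> D \<and> fst z \<in> B \<and> u \<in> C} z \<partial>P)"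
        using C fin by (intro sum.mono_neutral_right) auto
      also have "\<dots> = (\<Sum>u\<in>C. \<integral>\<^sup>+z. ennreal (p u (fst z)) * indicator ?R z \<partial>P)"
        by (intro sum.cong refl nn_integral_cong) auto
      also have "\<dots> = (\<integral>\<^sup>+z. (\<Sum>u\<in>C. ennreal (p u (fst z)) * indicator ?R z) \<partial>P)"
        using C by (intro nn_integral_sum[symmetric] borel_measurable_times_ennreal) auto
      also have "\<dots> = (\<integral>\<^sup>+z. ennreal (r (fst z)) * indicator ?R z \<partial>P)"
        using C p_pos unfolding r_def sum_distrib_right[symmetric]
        by (subst sum_ennreal) auto
      also have "\<dots> = (\<Sum>u\<in>A. \<integral>\<^sup>+z. ennreal (p u (fst z)) * (ennreal (r (fst z)) * indicator ?R z) \<partial>P)"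
        by (rule marginal[symmetric]) measurable
      also have "\<dots> = (\<Sum>u\<in>A. \<integral>\<^sup>+z. ennreal (p u (fst z)) *
          (ennreal (r (X (\<phi> u z))) * indicator {\<omega> \<in> space Q. (Y \<omega>, V \<omega>) \<in> D \<and> X \<omega> \<in> B} (\<phi> u z)) \<partial>P)"
        using \<phi>Q by (intro sum.cong refl nn_integral_cong) (auto split: split_indicator)
      also have "\<dots> = (\<integral>\<^sup>+\<omega>. ennreal (r (X \<omega>)) * indicator {\<omega> \<in> space Q. (Y \<omega>, V \<omega>) \<in> D \<and> X \<omega> \<in> B} \<omega> \<partial>Q)"
        by (rule integral_Q[symmetric]) measurable
      finally show "emeasure Q {\<omega> \<in> space Q. (Y \<omega>, V \<omega>) \<in> D \<and> X \<omega> \<in> B \<and> U \<omega> \<in> C} =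
        (\<integral>\<^sup>+\<omega>. ennreal (r (X \<omega>)) * indicator {\<omega> \<in> space Q. (Y \<omega>, V \<omega>) \<in> D \<and> X \<omega> \<in> B} \<omega> \<partial>Q)" .
    qed
  qed measurable
  then have mc1: "Q.markov_chain3 ?N MX (MY \<Otimes>\<^sub>M ?N) U X (\<lambda>\<omega>. (Y \<omega>, V \<omega>))"
    by (rule Q.markov_chain3_commute)
  have mc2: "Q.markov_chain3 (?N \<Otimes>\<^sub>M MX) MY ?N (\<lambda>\<omega>. (U \<omega>, X \<omega>)) Y V"
  proof (rule Q.markov_chain3I)
    fix C assume C[measurable]: "C \<in> sets ?N"
    \<comment> \<open>V is a function of Y, so its conditional probabilities given Y are
      indicators.\<close>
    define r :: "'c \<Rightarrow> real" where "r = indicator (v -` C \<inter> space MY)"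
    have r[measurable]: "r \<in> borel_measurable MY"
      unfolding r_def by measurable
    show "\<exists>r\<in>borel_measurable MY. (\<forall>y. 0 \<le> r y \<and> r y \<le> 1) \<and> (\<forall>D\<in>sets (?N \<Otimes>\<^sub>M MX). \<forall>B\<in>sets MY.
      emeasure Q {\<omega> \<in> space Q. (U \<omega>, X \<omega>) \<in> D \<and> Y \<omega> \<in> B \<and> V \<omega> \<in> C} =
      (\<integral>\<^sup>+\<omega>. ennreal (r (Y \<omega>)) * indicator {\<omega> \<in> space Q. (U \<omega>, X \<omega>) \<in> D \<and> Y \<omega> \<in> B} \<omega> \<partial>Q))"
    proof (intro bexI[of _ r] conjI allI ballI r)
      fix D B assume [measurable]: "D \<in> sets (?N \<Otimes>\<^sub>M MX)" "B \<in> sets MY"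
      have "emeasure Q {\<omega> \<in> space Q. (U \<omega>, X \<omega>) \<in> D \<and> Y \<omega> \<in> B \<and> V \<omega> \<in> C} =
         (\<Sum>u\<in>A. \<integral>\<^sup>+z. ennreal (p u (fst z)) * indicator {z \<in> space P. (u, fst z) \<in> D \<and> snd z \<in> B \<and> v (snd z) \<in> C} z \<partial>P)"
        by (subst emeasure_Q) auto
      also have "\<dots> = (\<Sum>u\<in>A. \<integral>\<^sup>+z. ennreal (p u (fst z)) *
          (ennreal (r (Y (\<phi> u z))) * indicator {\<omega> \<in> space Q. (U \<omega>, X \<omega>) \<in> D \<and> Y \<omega> \<in> B} (\<phi> u z)) \<partial>P)"
        using \<phi>Q by (intro sum.cong refl nn_integral_cong) (auto simp: r_def space_joint split: split_indicator)
      also have "\<dots> = (\<integral>\<^sup>+\<omega>. ennreal (r (Y \<omega>)) * indicator {\<omega> \<in> space Q. (U \<omega>, X \<omega>) \<in> D \<and> Y \<omega> \<in> B} \<omega> \<partial>Q)"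
        by (rule integral_Q[symmetric]) measurable
      finally show "emeasure Q {\<omega> \<in> space Q. (U \<omega>, X \<omega>) \<in> D \<and> Y \<omega> \<in> B \<and> V \<omega> \<in> C} =
        (\<integral>\<^sup>+\<omega>. ennreal (r (Y \<omega>)) * indicator {\<omega> \<in> space Q. (U \<omega>, X \<omega>) \<in> D \<and> Y \<omega> \<in> B} \<omega> \<partial>Q)" .
    qed (simp_all add: r_def split: split_indicator)
  qed measurable
  have "Q \<in> guessing_laws MX MY P A"
    unfolding guessing_laws_def using prob_Q sets_Q law mc1 mc2
    by (simp add: Q.markov_chain4_def U_def X_def Y_def V_def split_beta')
  moreover have "emeasure Q {(u, x, y, w) \<in> space Q. u = a} = (\<integral>\<^sup>+z. ennreal (p a (fst z)) \<partial>P)" if a: "a \<in> A" for a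
  proof -
    have a'[measurable]: "{a} \<in> sets ?N" using a by simp
    have "{(u, x, y, w) \<in> space Q. u = a} = {\<omega> \<in> space Q. U \<omega> \<in> {a}}"
      by (auto simp: U_def)
    then have "emeasure Q {(u, x, y, w) \<in> space Q. u = a} =
       (\<Sum>u\<in>A. \<integral>\<^sup>+z. ennreal (p u (fst z)) * indicator {z \<in> space P. u \<in> {a}} z \<partial>P)"
      by (simp only:) (subst emeasure_Q, auto)
    also have "\<dots> = (\<Sum>u\<in>{a}. \<integral>\<^sup>+z. ennreal (p u (fst z)) * indicator {z \<in> space P. u \<in> {a}} z \<partial>P)"
      using a fin by (intro sum.mono_neutral_right) auto
    also have "\<dots> = (\<integral>\<^sup>+z. ennreal (p a (fst z)) \<partial>P)"
      by (auto intro!: nn_integral_cong)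
    finally show ?thesis .
  qed
  moreover have "emeasure Q {(u, x, y, w) \<in> space Q. u = w} = (\<integral>\<^sup>+z. ennreal (p (v (snd z)) (fst z)) \<partial>P)"
  proof -
    have [measurable]: "{\<omega> \<in> space Q. U \<omega> = V \<omega>} \<in> sets Q"
    proof -
      have "{\<omega> \<in> space Q. U \<omega> = V \<omega>} = (\<Union>a\<in>A. {\<omega> \<in> space Q. U \<omega> \<in> {a} \<and> V \<omega> \<in> {a}})"
        by (auto simp: space_Q U_def V_def)
      also have "\<dots> \<in> sets Q"
        using fin by (intro sets.finite_UN) auto
      finally show ?thesis .
    qed
    have "{(u, x, y, w) \<in> space Q. u = w} = {\<omega> \<in> space Q. U \<omega> = V \<omega>}"
      by (auto simp: U_def V_def)
    then have "emeasure Q {(u, x, y, w) \<in> space Q. u = w} =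
       (\<Sum>u\<in>A. \<integral>\<^sup>+z. ennreal (p u (fst z)) * indicator {z \<in> space P. u = v (snd z)} z \<partial>P)"
      by (simp only:) (subst emeasure_Q, auto)
    also have "\<dots> = (\<integral>\<^sup>+z. (\<Sum>u\<in>A. ennreal (p u (fst z)) * indicator {z \<in> space P. u = v (snd z)} z) \<partial>P)"
      by (rule nn_integral_sum[symmetric]) measurable
    also have "\<dots> = (\<integral>\<^sup>+z. ennreal (p (v (snd z)) (fst z)) \<partial>P)"
    proof (rule nn_integral_cong)
      fix z assume z: "z \<in> space P"
      then have "v (snd z) \<in> A"
        using measurable_space[OF v, of "snd z"] by (auto simp: space_joint)
      moreover have "(\<Sum>u\<in>A. ennreal (p u (fst z)) * indicator {z \<in> space P. u = v (snd z)} z) =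
          (\<Sum>u\<in>A. if u = v (snd z) then ennreal (p u (fst z)) else 0)"
        using z by (intro sum.cong) auto
      ultimately show "(\<Sum>u\<in>A. ennreal (p u (fst z)) * indicator {z \<in> space P. u = v (snd z)} z) = ennreal (p (v (snd z)) (fst z))"
        using fin by simp
    qed
    finally show ?thesis .
  qed
  ultimately show ?thesis by blast
qed

end

section \<open>Logarithms of extended nonnegative numbers\<close>

definition eln :: "ennreal \<Rightarrow> ereal" where
  "eln s = (if s = \<top> then \<infinity> else elog (enn2real s))"

lemma elog_mono: "0 \<le> r \<Longrightarrow> r \<le> s \<Longrightarrow> elog r \<le> elog s"
  by (auto simp: elog_def)

lemma le_exp_if_elog_le:
  assumes "0 \<le> r" "elog r \<le> ereal l"
  shows "r \<le> exp l"
proof (cases "r = 0")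
  case False
  with assms have "exp (ln r) \<le> exp l" by (simp add: elog_def del: exp_ln)
  with False assms(1) show ?thesis by simp
qed simp

lemma eln_ennreal: "0 \<le> r \<Longrightarrow> eln (ennreal r) = elog r"
  by (simp add: eln_def)

lemma eln_mono: "s \<le> t \<Longrightarrow> eln s \<le> eln t"
  by (auto simp: eln_def top_unique less_top[symmetric] intro!: elog_mono enn2real_mono)

lemma eln_eq_0_iff: "1 \<le> s \<Longrightarrow> eln s = 0 \<longleftrightarrow> s = 1"
proof (cases s)
  case (real r)
  moreover assume "1 \<le> s"
  ultimately show ?thesis by (simp add: eln_ennreal elog_def)
qed (simp add: eln_def)

lemma eln_nonneg: "1 \<le> s \<Longrightarrow> 0 \<le> eln s"
  using eln_mono[of 1 s] eln_eq_0_iff[of 1] by simp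

text \<open>The lower bounds exclude the product of 0 and infinity, for which the law fails: that
  product is 0, while the sum of the extended logarithms is infinity.\<close>

lemma eln_mult:
  assumes "1 \<le> s" "1 \<le> t"
  shows "eln (s * t) = eln s + eln t"
proof (cases "s = \<top> \<or> t = \<top>")
  case True
  then show ?thesis
    using assms eln_nonneg[OF assms(1)] eln_nonneg[OF assms(2)]
    by (auto simp: eln_def ennreal_mult_eq_top_iff)
next
  case False
  then obtain a b where ab: "s = ennreal a" "t = ennreal b" "0 \<le> a" "0 \<le> b"
    by (cases s; cases t) auto
  with assms have "1 \<le> a" "1 \<le> b" by simp_all
  with ab show ?thesis
    by (simp add: eln_ennreal ennreal_mult[symmetric] elog_def ln_mult)
qed

lemma eln_prod:
  assumes "\<And>i. i \<in> I \<Longrightarrow> 1 \<le> s i"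
  shows "eln (\<Prod>i\<in>I. s i) = (\<Sum>i\<in>I. eln (s i))"
  using assms
proof (induction I rule: infinite_finite_induct)
  case (insert i I)
  have "1 \<le> prod s I" using insert.prems by (intro prod_ge_1) auto
  then show ?case using insert by (simp add: eln_mult)
qed (simp_all add: eln_eq_0_iff)

section \<open>Achievability, and the leakage as the logarithm of the gain\<close>

context joint_law
begin

text \<open>Success has probability at least c times the sum, and no letter has mass above c, so c
  cancels in the quotient.\<close>

lemma elog_sum_ratio_le_leakage:
  fixes n :: nat
  assumes A: "\<And>j. j < n \<Longrightarrow> A j \<in> sets MX" and B: "\<And>j. j < n \<Longrightarrow> B j \<in> sets MY"
    and dis: "disjoint_family_on B {..<n}"
  shows "\<exists>K. \<exists>Q\<in>guessing_laws MX MY P {..<K}.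
    elog (\<Sum>j<n. measure P (A j \<times> B j) / measure P (A j \<times> space MY)) \<le>
      elog (measure Q {(u, x, y, v) \<in> space Q. u = v} /
            Max ((\<lambda>a. measure Q {(u, x, y, v) \<in> space Q. u = a}) ` {..<K}))"
proof -
  define \<alpha> where "\<alpha> j = measure P (A j \<times> space MY)" for j
  \<comment> \<open>Small enough that the weights c / \<open>\<alpha> j\<close> sum to at most 1
    even at a point lying in all the A j. The summand 1 in the denominator keeps c positive and at
    most 1, also when every \<open>1 / \<alpha> j\<close> is 0.\<close>
  define c where "c = 1 / (1 + (\<Sum>j<n. 1 / \<alpha> j))"
  have \<alpha>_pos: "0 \<le> \<alpha> j" for j by (simp add: \<alpha>_def)
  have sum_pos: "0 \<le> (\<Sum>j<n. 1 / \<alpha> j)" by (intro sum_nonneg) (simp add: \<alpha>_pos)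
  have c: "0 < c" "c \<le> 1" using sum_pos by (simp_all add: c_def)
  \<comment> \<open>The leftover mass is at most 1, so K >= 1 / c equal shares are each at most
    c.\<close>
  define K where "K = nat \<lceil>1 / c\<rceil>"
  have K: "1 / c \<le> real K" unfolding K_def by linarith
  then have K0: "0 < K" using c by (cases K) (auto simp: field_simps)
  have Kc: "1 / real K \<le> c" using K K0 c by (simp add: field_simps)
  \<comment> \<open>Letter j receives mass exactly c, except that \<open>q j\<close> vanishes when A
    j is null, by division by 0.\<close>
  define q where "q j x = c * indicator (A j) x / \<alpha> j" for j x
  have q_pos: "0 \<le> q j x" for j x using c \<alpha>_pos by (simp add: q_def)
  have q_le: "(\<Sum>j<n. q j x) \<le> 1" for x
  proof -
    have "(\<Sum>j<n. q j x) \<le> (\<Sum>j<n. c * (1 / \<alpha> j))"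
      unfolding q_def using c \<alpha>_pos
      by (intro sum_mono) (auto split: split_indicator)
    also have "\<dots> = c * (\<Sum>j<n. 1 / \<alpha> j)" by (rule sum_distrib_left[symmetric])
    also have "\<dots> \<le> 1" using sum_pos by (simp add: c_def)
    finally show ?thesis .
  qed
  \<comment> \<open>The letters n, ..., n + K - 1 are the dummies and share equally what
    \<open>q\<close> leaves over at x.\<close>
  define p where "p u x = (if u < n then q u x else (1 - (\<Sum>j<n. q j x)) / real K)" for u x
  \<comment> \<open>Disjointness of the B j makes the choice unique. Outside their union the guess
    is n, the first dummy letter, which exists because K > 0.\<close>
  define v where "v y = (if \<exists>j<n. y \<in> B j then SOME j. j < n \<and> y \<in> B j else n)" for y
  have v_eq: "v y = j" if "j < n" "y \<in> B j" for j y
  proof -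
    have "\<exists>j<n. y \<in> B j" using that by blast
    moreover have "(SOME j. j < n \<and> y \<in> B j) = j"
      using that dis by (intro some_equality) (auto simp: disjoint_family_on_def)
    ultimately show ?thesis by (simp add: v_def)
  qed
  have v_none: "v y = n" if "\<And>j. j < n \<Longrightarrow> y \<notin> B j" for y
    using that by (auto simp: v_def)
  let ?A = "{..<n + K}"
  have [measurable]: "q u \<in> borel_measurable MX" if "u < n" for u
    using A[OF that] unfolding q_def by measurable
  have p_meas: "p u \<in> borel_measurable MX" for u
  proof (cases "u < n")
    case False
    have "(\<lambda>x. \<Sum>j<n. q j x) \<in> borel_measurable MX"
      by (intro borel_measurable_sum) auto
    with False show ?thesis by (simp add: p_def[abs_def])
  qed (simp add: p_def[abs_def])
  have p_pos: "0 \<le> p u x" for u x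
    using q_pos q_le[of x] by (simp add: p_def)
  have p_sum: "(\<Sum>u\<in>?A. p u x) = 1" for x
  proof -
    have "(\<Sum>u\<in>?A. p u x) = (\<Sum>u<n. p u x) + (\<Sum>u\<in>{n..<n+K}. p u x)"
      by (subst sum.union_disjoint[symmetric]) (auto intro!: sum.cong)
    also have "\<dots> = 1" using K0 by (simp add: p_def)
    finally show ?thesis .
  qed
  have v_meas: "v \<in> measurable MY (count_space ?A)"
  proof (subst measurable_count_space_eq2)
    have "v y \<in> ?A" for y
      using v_eq v_none K0 by (cases "\<exists>j<n. y \<in> B j") auto
    moreover have "v -` {k} \<inter> space MY \<in> sets MY" for k
    proof -
      consider "k < n" | "k = n" | "n < k" by linarith
      then show ?thesis
      proof cases
        case 1
        have "v -` {k} \<inter> space MY = B k"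
          using 1 v_eq v_none sets.sets_into_space[OF B[OF 1]] by (auto, metis nat_neq_iff)
        then show ?thesis using B[OF 1] by simp
      next
        case 2
        have "v -` {k} \<inter> space MY = space MY - (\<Union>j<n. B j)"
          using 2 v_eq v_none by auto
        then show ?thesis using B by auto
      next
        case 3
        then have "v -` {k} \<inter> space MY = {}"
          using v_eq v_none by (auto, metis less_asym nat_neq_iff)
        then show ?thesis by simp
      qed
    qed
    ultimately show "v \<in> space MY \<rightarrow> ?A \<and> (\<forall>a\<in>?A. v -` {a} \<inter> space MY \<in> sets MY)" by auto
  qed simp
  from ex_guessing_law[of ?A p v] p_meas p_pos p_sum v_meas obtain Q
    where Q: "Q \<in> guessing_laws MX MY P ?A"
      and QU: "\<And>a. a \<in> ?A \<Longrightarrow> emeasure Q {(u, x, y, w) \<in> space Q. u = a} = (\<integral>\<^sup>+z. ennreal (p a (fst z)) \<partial>P)"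
      and QV: "emeasure Q {(u, x, y, w) \<in> space Q. u = w} = (\<integral>\<^sup>+z. ennreal (p (v (snd z)) (fst z)) \<partial>P)"
    by auto
  have "prob_space Q" using Q by (simp add: guessing_laws_def)
  then interpret Q: prob_space Q .
  let ?m = "\<lambda>a. measure Q {(u, x, y, v) \<in> space Q. u = a}"
  let ?M = "Max (?m ` ?A)"
  have q_int: "(\<integral>\<^sup>+z. ennreal (q j (fst z)) * indicator D (snd z) \<partial>P) = ennreal (c * (measure P (A j \<times> D) / \<alpha> j))"
    if j: "j < n" and D: "D \<in> sets MY" for j D
  proof -
    have "(\<integral>\<^sup>+z. ennreal (q j (fst z)) * indicator D (snd z) \<partial>P) = (\<integral>\<^sup>+z. ennreal (c / \<alpha> j) * indicator (A j \<times> D) z \<partial>P)"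
      by (intro nn_integral_cong) (auto simp: q_def indicator_times split: split_indicator)
    also have "\<dots> = ennreal (c / \<alpha> j) * emeasure P (A j \<times> D)"
      using j D A by (intro nn_integral_cmult_indicator rectangle_joint) auto
    also have "\<dots> = ennreal (c * (measure P (A j \<times> D) / \<alpha> j))"
      using c \<alpha>_pos by (simp add: emeasure_eq_measure ennreal_mult[symmetric])
    finally show ?thesis .
  qed
  have m_le: "?m a \<le> c" if a: "a \<in> ?A" for a
  proof -
    have "ennreal (?m a) = (\<integral>\<^sup>+z. ennreal (p a (fst z)) \<partial>P)"
      using QU[OF a] by (simp add: Q.emeasure_eq_measure)
    also have "\<dots> \<le> ennreal c"
    proof (cases "a < n")
      case True
      have "(\<integral>\<^sup>+z. ennreal (p a (fst z)) \<partial>P) = (\<integral>\<^sup>+z. ennreal (q a (fst z)) * indicator (space MY) (snd z) \<partial>P)"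
        using True by (intro nn_integral_cong) (auto simp: p_def space_joint)
      also have "\<dots> = ennreal (c * (\<alpha> a / \<alpha> a))"
        using q_int[OF True sets.top] by (simp add: \<alpha>_def)
      also have "\<dots> \<le> ennreal c" using c by (intro ennreal_leI) auto
      finally show ?thesis .
    next
      case False
      have "p a x \<le> c" for x
      proof -
        have "p a x \<le> 1 / real K"
          using False q_pos by (simp add: p_def divide_right_mono sum_nonneg)
        with Kc show ?thesis by linarith
      qed
      then have "(\<integral>\<^sup>+z. ennreal (p a (fst z)) \<partial>P) \<le> (\<integral>\<^sup>+z. ennreal c \<partial>P)"
        by (intro nn_integral_mono ennreal_leI)
      then show ?thesis by (simp add: emeasure_space_1)
    qed
    finally show ?thesis using c by (subst (asm) ennreal_le_iff) auto
  qed
  have ne: "?A \<noteq> {}" using K0 by auto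
  have M_le: "?M \<le> c" using m_le ne by (subst Max_le_iff) auto
  \<comment> \<open>The letter masses sum to 1, so they cannot all vanish; otherwise the quotient
    would be 0 by convention.\<close>
  have M_pos: "0 < ?M"
  proof (rule ccontr)
    assume "\<not> 0 < ?M"
    moreover have "?m a \<le> ?M" if "a \<in> ?A" for a
      using that by (intro Max_ge) auto
    ultimately have "?m a \<le> 0" if "a \<in> ?A" for a
      using that by (meson linorder_not_less order_trans)
    then have "emeasure Q {(u, x, y, w) \<in> space Q. u = a} = 0" if "a \<in> ?A" for a
      using that by (simp add: Q.emeasure_eq_measure measure_le_0_iff)
    then have "(\<Sum>a\<in>?A. \<integral>\<^sup>+z. ennreal (p a (fst z)) \<partial>P) = 0"
      using QU by simp
    moreover have "(\<Sum>a\<in>?A. \<integral>\<^sup>+z. ennreal (p a (fst z)) \<partial>P) = (\<integral>\<^sup>+z. (\<Sum>a\<in>?A. ennreal (p a (fst z))) \<partial>P)"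
      using p_meas by (intro nn_integral_sum[symmetric]) auto
    moreover have "\<dots> = 1"
      using p_sum p_pos by (simp add: sum_ennreal emeasure_space_1)
    ultimately show False by simp
  qed
  let ?s = "\<Sum>j<n. measure P (A j \<times> B j) / \<alpha> j"
  let ?V = "measure Q {(u, x, y, w) \<in> space Q. u = w}"
  have s_pos: "0 \<le> ?s" using \<alpha>_pos by (intro sum_nonneg) simp
  have "ennreal (c * ?s) = (\<Sum>j<n. ennreal (c * (measure P (A j \<times> B j) / \<alpha> j)))"
    using c \<alpha>_pos by (simp add: sum_distrib_left sum_ennreal)
  also have "\<dots> = (\<Sum>j<n. \<integral>\<^sup>+z. ennreal (q j (fst z)) * indicator (B j) (snd z) \<partial>P)"
    using B by (intro sum.cong refl q_int[symmetric]) auto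
  also have "\<dots> = (\<integral>\<^sup>+z. (\<Sum>j<n. ennreal (q j (fst z)) * indicator (B j) (snd z)) \<partial>P)"
    using B by (intro nn_integral_sum[symmetric] borel_measurable_times_ennreal) auto
  \<comment> \<open>Only an inequality, because a dummy guess made outside all the B j may be
    correct too.\<close>
  also have "\<dots> \<le> (\<integral>\<^sup>+z. ennreal (p (v (snd z)) (fst z)) \<partial>P)"
  proof (rule nn_integral_mono)
    fix z
    have "(\<Sum>j<n. ennreal (q j (fst z)) * indicator (B j) (snd z)) =
        (\<Sum>j<n. if j = v (snd z) then ennreal (q j (fst z)) * indicator (B j) (snd z) else 0)"
      using v_eq by (intro sum.cong) (auto split: split_indicator)
    also have "\<dots> \<le> ennreal (p (v (snd z)) (fst z))"
      by (auto simp: p_def split: split_indicator)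
    finally show "(\<Sum>j<n. ennreal (q j (fst z)) * indicator (B j) (snd z)) \<le> ennreal (p (v (snd z)) (fst z))" .
  qed
  also have "\<dots> = ennreal ?V"
    using QV by (simp add: Q.emeasure_eq_measure)
  finally have "c * ?s \<le> ?V" by (subst (asm) ennreal_le_iff) auto
  moreover have "?M * ?s \<le> c * ?s" using M_le s_pos by (rule mult_right_mono)
  ultimately have "?s \<le> ?V / ?M" using M_pos by (simp add: pos_le_divide_eq mult.commute)
  then have "elog ?s \<le> elog (?V / ?M)" using s_pos by (intro elog_mono)
  with Q show ?thesis unfolding \<alpha>_def by blast
qed

text \<open>The converse is \<open>guessing_success_le\<close> with a tight g, and achievability is
  \<open>elog_sum_ratio_le_leakage\<close>. A bare law P suffices, since the leakage depends on the
  variables only through their joint law.\<close>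

lemma SUP_guessing_laws_eq:
  "(SUP (A, Q) \<in> (SIGMA A:{A. finite A}. guessing_laws MX MY P A).
      elog (measure Q {(u, x, y, v) \<in> space Q. u = v} /
            Max ((\<lambda>a. measure Q {(u, x, y, v) \<in> space Q. u = a}) ` A))) = eln (guessing_gain MX MY P)"
  (is "?L = _")
proof (rule antisym)
  show "?L \<le> eln (guessing_gain MX MY P)"
  proof (cases "guessing_gain MX MY P = \<top>")
    case False
    then have fin: "guessing_gain MX MY P < \<top>" by (simp add: less_top)
    then obtain g where g: "leakage_density MX MY P g" "(\<integral>\<^sup>+z. g (snd z) \<partial>P) \<le> guessing_gain MX MY P"
      using ex_leakage_density by blast
    obtain s where s: "guessing_gain MX MY P = ennreal s" "0 \<le> s"
      using fin by (cases "guessing_gain MX MY P") auto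
    show ?thesis
    proof (rule SUP_least, clarify)
      fix A Q assume A: "finite A" and Q: "Q \<in> guessing_laws MX MY P A"
      have "prob_space Q" using Q by (simp add: guessing_laws_def)
      then interpret Q: prob_space Q .
      let ?m = "\<lambda>a. measure Q {(u, x, y, v) \<in> space Q. u = a}"
      let ?M = "Max (?m ` A)" and ?V = "measure Q {(u, x, y, v) \<in> space Q. u = v}"
      \<comment> \<open>An empty alphabet would make the space of Q empty, and \<open>Max\<close>
        needs a nonempty set.\<close>
      have "A \<noteq> {}"
      proof
        assume "A = {}"
        then have "space Q = {}"
          using Q by (auto simp: guessing_laws_def space_pair_measure dest: sets_eq_imp_space_eq)
        then show False using Q.not_empty by simp
      qed
      then have M0: "0 \<le> ?M" using A by (subst Max_ge_iff) (auto simp: ex_in_conv)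
      have "ennreal ?V \<le> ennreal ?M * ennreal s"
        unfolding s(1)[symmetric] Q.emeasure_eq_measure[symmetric]
        using guessing_success_le[OF g(1) A Q] g(2) by (rule order_trans[OF _ mult_left_mono]) simp
      then have "?V \<le> ?M * s" using M0 s(2) by (simp add: ennreal_mult[symmetric])
      \<comment> \<open>When \<open>?M\<close> is 0 the quotient is 0 and the bound
        persists.\<close>
      then have "?V / ?M \<le> s" using M0 s(2) by (cases "?M = 0") (auto simp: field_simps)
      then show "elog (?V / ?M) \<le> eln (guessing_gain MX MY P)"
        unfolding s(1) eln_ennreal[OF s(2)] using M0 by (intro elog_mono) auto
    qed
  qed (simp add: eln_def)
  have ratio_le: "elog (\<Sum>j<n. measure P (A j \<times> B j) / measure P (A j \<times> space MY)) \<le> ?L"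
    if "\<And>j. j < n \<Longrightarrow> A j \<in> sets MX" "\<And>j. j < n \<Longrightarrow> B j \<in> sets MY" "disjoint_family_on B {..<n}"
    for n :: nat and A B
  proof -
    note AB = that
    obtain K Q where "Q \<in> guessing_laws MX MY P {..<K}"
      "elog (\<Sum>j<n. measure P (A j \<times> B j) / measure P (A j \<times> space MY)) \<le>
      elog (measure Q {(u, x, y, v) \<in> space Q. u = v} /
            Max ((\<lambda>a. measure Q {(u, x, y, v) \<in> space Q. u = a}) ` {..<K}))"
      using elog_sum_ratio_le_leakage[of n A B, OF AB] by blast
    then show ?thesis by (intro SUP_upper2[of "({..<K}, Q)"]) auto
  qed
  show "eln (guessing_gain MX MY P) \<le> ?L"
  proof (cases ?L)
    case (real l)
    have "guessing_gain MX MY P \<le> ennreal (exp l)"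
      unfolding guessing_gain_def
    proof (rule SUP_least, clarify)
      fix n :: nat and A B
      assume "A \<in> {..<n} \<rightarrow> sets MX" "B \<in> {..<n} \<rightarrow> sets MY" "disjoint_family_on B {..<n}"
      then have "elog (\<Sum>j<n. measure P (A j \<times> B j) / measure P (A j \<times> space MY)) \<le> ereal l"
        unfolding real[symmetric] by (intro ratio_le) auto
      moreover have "0 \<le> (\<Sum>j<n. measure P (A j \<times> B j) / measure P (A j \<times> space MY))"
        by (intro sum_nonneg) simp
      ultimately show "ennreal (\<Sum>j<n. measure P (A j \<times> B j) / measure P (A j \<times> space MY)) \<le> ennreal (exp l)"
        by (intro ennreal_leI le_exp_if_elog_le)
    qed
    then have "eln (guessing_gain MX MY P) \<le> eln (ennreal (exp l))" by (rule eln_mono)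
    also have "\<dots> = ereal l" by (simp add: eln_ennreal elog_def)
    also have "\<dots> = ?L" by (rule real[symmetric])
    finally show ?thesis .
  next
    \<comment> \<open>Impossible: the pair of whole spaces has ratio 1, whose logarithm is
      0.\<close>
    case MInf
    then show ?thesis
      using ratio_le[of 1 "\<lambda>_. space MX" "\<lambda>_. space MY"] prob_space
      by (simp add: disjoint_family_on_def space_joint[symmetric] elog_def)
  qed simp
qed

end

lemma (in prob_space) joint_law_distr:
  assumes [measurable]: "random_variable MX X" "random_variable MY Y"
  shows "joint_law (distr M (MX \<Otimes>\<^sub>M MY) (\<lambda>\<omega>. (X \<omega>, Y \<omega>))) MX MY"
proof -
  interpret D: prob_space "distr M (MX \<Otimes>\<^sub>M MY) (\<lambda>\<omega>. (X \<omega>, Y \<omega>))"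
    by (rule prob_space_distr) measurable
  show ?thesis by unfold_locales simp
qed

lemma (in prob_space) maximal_leakage_eq:
  assumes "random_variable MX X" "random_variable MY Y"
  shows "maximal_leakage MX MY X Y =
    eln (guessing_gain MX MY (distr M (MX \<Otimes>\<^sub>M MY) (\<lambda>\<omega>. (X \<omega>, Y \<omega>))))"
  unfolding maximal_leakage_def by (rule joint_law.SUP_guessing_laws_eq[OF joint_law_distr[OF assms]])

section \<open>Independence\<close>

context joint_law
begin

text \<open>If the gain is 1, the two-term family (A, B), (whole space, complement of B) shows that
  conditioning on A cannot raise the probability of B. The same for the complement of B shows that
  it cannot lower it either.\<close>

lemma guessing_gain_eq_1_iff:
  "guessing_gain MX MY P = 1 \<longleftrightarrow>
    indep_set {fst -` A \<inter> space P | A. A \<in> sets MX} {snd -` B \<inter> space P | B. B \<in> sets MY}"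
proof -
  have rect: "fst -` A \<inter> space P = A \<times> space MY" "snd -` B \<inter> space P = space MX \<times> B"
    "(A \<times> space MY) \<inter> (space MX \<times> B) = A \<times> B"
    if "A \<in> sets MX" "B \<in> sets MY" for A B
    using sets.sets_into_space[OF that(1)] sets.sets_into_space[OF that(2)] by (auto simp: space_joint)
  have "guessing_gain MX MY P = 1 \<longleftrightarrow>
    (\<forall>A\<in>sets MX. \<forall>B\<in>sets MY. prob (A \<times> B) = prob (A \<times> space MY) * prob (space MX \<times> B))"
  proof (intro iffI ballI)
    assume gain: "guessing_gain MX MY P = 1"
    have le: "prob (A \<times> B) \<le> prob (A \<times> space MY) * prob (space MX \<times> B)"
      and split: "prob (A \<times> B) + prob (A \<times> (space MY - B)) = prob (A \<times> space MY)"
      if A: "A \<in> sets MX" and B: "B \<in> sets MY" for A B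
    proof -
      have add: "prob (C \<times> B) + prob (C \<times> (space MY - B)) = prob (C \<times> space MY)" if C: "C \<in> sets MX" for C
      proof -
        have "C \<times> space MY = (C \<times> B) \<union> (C \<times> (space MY - B))"
          using sets.sets_into_space[OF B] by auto
        then show ?thesis
          using B C by (simp only:) (intro finite_measure_Union[symmetric], auto intro: rectangle_joint)
      qed
      show "prob (A \<times> B) + prob (A \<times> (space MY - B)) = prob (A \<times> space MY)" by (rule add[OF A])
      \<comment> \<open>Gain 1 on this family reads P(Y in B | X in A) + P(Y not in B) <= 1.\<close>
      have "ennreal (\<Sum>j<(2::nat). prob ((if j = 0 then A else space MX) \<times> (if j = 0 then B else space MY - B)) /
          prob ((if j = 0 then A else space MX) \<times> space MY)) \<le> 1"
        unfolding gain[symmetric] using A B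
        by (intro guessing_gain_ge) (auto simp: disjoint_family_on_def)
      then have "prob (A \<times> B) / prob (A \<times> space MY) + prob (space MX \<times> (space MY - B)) \<le> 1"
        using prob_space by (simp add: numeral_2_eq_2 space_joint[symmetric] del: ennreal_plus)
      then have *: "prob (A \<times> B) / prob (A \<times> space MY) \<le> prob (space MX \<times> B)"
        using add[OF sets.top] prob_space by (simp add: space_joint[symmetric])
      show "prob (A \<times> B) \<le> prob (A \<times> space MY) * prob (space MX \<times> B)"
      proof (cases "prob (A \<times> space MY) = 0")
        case True
        then show ?thesis using measure_rectangle_mono[OF A B] by simp
      next
        case False
        then have "0 < prob (A \<times> space MY)" by (simp add: zero_less_measure_iff)
        then show ?thesis using * by (simp add: pos_divide_le_eq mult.commute)
      qed
    qed
    fix A B assume A: "A \<in> sets MX" and B: "B \<in> sets MY"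
    \<comment> \<open>The probabilities of B and of its complement within A add up to that of A, so
      the bound for the complement is the reverse inequality for B.\<close>
    have B': "space MY - B \<in> sets MY" using B by simp
    have "prob (space MX \<times> (space MY - B)) = 1 - prob (space MX \<times> B)"
      using split[OF sets.top B] prob_space by (simp add: space_joint[symmetric])
    then have "prob (A \<times> (space MY - B)) \<le> prob (A \<times> space MY) * (1 - prob (space MX \<times> B))"
      using le[OF A B'] by simp
    then show "prob (A \<times> B) = prob (A \<times> space MY) * prob (space MX \<times> B)"
      using le[OF A B] split[OF A B] by (simp add: algebra_simps)
  next
    assume ind: "\<forall>A\<in>sets MX. \<forall>B\<in>sets MY. prob (A \<times> B) = prob (A \<times> space MY) * prob (space MX \<times> B)"
    have "leakage_density MX MY P (\<lambda>_. 1)"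
      unfolding leakage_density_def
    proof (intro conjI ballI)
      fix A B assume A: "A \<in> sets MX" and B: "B \<in> sets MY"
      have "(\<integral>\<^sup>+z. 1 * indicator B (snd z) \<partial>P) = (\<integral>\<^sup>+z. indicator (space MX \<times> B) z \<partial>P)"
        by (intro nn_integral_cong) (auto simp: space_joint split: split_indicator)
      also have "\<dots> = emeasure P (space MX \<times> B)" using B by (simp add: rectangle_joint)
      finally show "emeasure P (A \<times> B) \<le> emeasure P (A \<times> space MY) * (\<integral>\<^sup>+z. 1 * indicator B (snd z) \<partial>P)"
        using ind[rule_format, OF A B] by (simp add: emeasure_eq_measure ennreal_mult)
    qed simp
    then have "guessing_gain MX MY P \<le> (\<integral>\<^sup>+z. 1 \<partial>P)" by (rule guessing_gain_le)
    then show "guessing_gain MX MY P = 1"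
      using guessing_gain_ge_1 by (simp add: emeasure_space_1)
  qed
  also have "\<dots> \<longleftrightarrow> indep_set {fst -` A \<inter> space P | A. A \<in> sets MX} {snd -` B \<inter> space P | B. B \<in> sets MY}"
    unfolding indep_sets2_eq
  proof (intro iffI conjI ballI)
    assume ind: "\<forall>A\<in>sets MX. \<forall>B\<in>sets MY. prob (A \<times> B) = prob (A \<times> space MY) * prob (space MX \<times> B)"
    fix a b assume "a \<in> {fst -` A \<inter> space P | A. A \<in> sets MX}" "b \<in> {snd -` B \<inter> space P | B. B \<in> sets MY}"
    then obtain A B where AB: "A \<in> sets MX" "B \<in> sets MY"
      and ab: "a = fst -` A \<inter> space P" "b = snd -` B \<inter> space P" by auto
    show "prob (a \<inter> b) = prob a * prob b"
      unfolding ab rect[OF AB] by (rule ind[rule_format, OF AB])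
  next
    fix A B assume A: "A \<in> sets MX" and B: "B \<in> sets MY"
    assume "{fst -` A \<inter> space P | A. A \<in> sets MX} \<subseteq> events \<and> {snd -` B \<inter> space P | B. B \<in> sets MY} \<subseteq> events \<and>
      (\<forall>a\<in>{fst -` A \<inter> space P | A. A \<in> sets MX}. \<forall>b\<in>{snd -` B \<inter> space P | B. B \<in> sets MY}.
        prob (a \<inter> b) = prob a * prob b)"
    then have "prob ((fst -` A \<inter> space P) \<inter> (snd -` B \<inter> space P)) = prob (fst -` A \<inter> space P) * prob (snd -` B \<inter> space P)"
      using A B by blast
    then show "prob (A \<times> B) = prob (A \<times> space MY) * prob (space MX \<times> B)"
      using A B by (simp add: rect)
  qed auto
  finally show ?thesis .
qed

end

text \<open>On the semiring of rectangles, R - P is nonnegative by hypothesis and countably additive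
  because P and R are, so Caratheodory extends it to a measure D. The equation R = D + P then
  spreads from rectangles to all sets by a Dynkin argument.\<close>

lemma emeasure_pair_mono_rectangles:
  assumes sets: "sets P = sets (MX \<Otimes>\<^sub>M MY)" "sets R = sets (MX \<Otimes>\<^sub>M MY)"
    and fin: "finite_measure P" "finite_measure R"
    and le: "\<And>A B. A \<in> sets MX \<Longrightarrow> B \<in> sets MY \<Longrightarrow> emeasure P (A \<times> B) \<le> emeasure R (A \<times> B)"
    and E: "E \<in> sets (MX \<Otimes>\<^sub>M MY)"
  shows "emeasure P E \<le> emeasure R E"
proof -
  let ?\<Omega> = "space MX \<times> space MY"
  let ?I = "\<lambda>A B. A \<in> sets MX \<and> B \<in> sets MY"
  let ?G = "\<lambda>A B. A \<times> B :: ('a \<times> 'b) set"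
  let ?\<mu> = "\<lambda>A B. emeasure R (A \<times> B) - emeasure P (A \<times> B)"
  define D where "D = extend_measure ?\<Omega> {(A, B). ?I A B} (\<lambda>(A, B). ?G A B) (\<lambda>(A, B). ?\<mu> A B)"
  have gen: "(\<lambda>(A, B). ?G A B) ` {(A, B). ?I A B} = {A \<times> B | A B. A \<in> sets MX \<and> B \<in> sets MY}"
    by auto
  have closed: "{A \<times> B | A B. A \<in> sets MX \<and> B \<in> sets MY} \<subseteq> Pow ?\<Omega>"
    by (rule pair_measure_closed)
  have sets_D: "sets D = sets (MX \<Otimes>\<^sub>M MY)"
    unfolding D_def using closed by (subst sets_extend_measure) (simp_all only: gen sets_pair_measure)
  have space: "space P = ?\<Omega>" "space R = ?\<Omega>" "space D = ?\<Omega>"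
    using sets_eq_imp_space_eq[OF sets(1)] sets_eq_imp_space_eq[OF sets(2)] sets_eq_imp_space_eq[OF sets_D]
    by (simp_all add: space_pair_measure)
  interpret P: finite_measure P by fact
  interpret R: finite_measure R by fact
  have semi: "semiring_of_sets ?\<Omega> {?G A B | A B. ?I A B}"
  proof
    show "{?G A B | A B. ?I A B} \<subseteq> Pow ?\<Omega>" by (rule closed)
    show "{} \<in> {?G A B | A B. ?I A B}" by (auto intro!: exI[of _ "{}"])
    fix a b assume "a \<in> {?G A B | A B. ?I A B}" "b \<in> {?G A B | A B. ?I A B}"
    then obtain A B C D where ab: "a = A \<times> B" "b = C \<times> D"
      and [measurable]: "A \<in> sets MX" "B \<in> sets MY" "C \<in> sets MX" "D \<in> sets MY" by auto
    have "a \<inter> b = (A \<inter> C) \<times> (B \<inter> D)" unfolding ab by auto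
    then show "a \<inter> b \<in> {?G A B | A B. ?I A B}"
    proof -
      have "A \<inter> C \<in> sets MX" "B \<inter> D \<in> sets MY" by measurable
      then show ?thesis unfolding \<open>a \<inter> b = _\<close> by blast
    qed
    show "\<exists>F\<subseteq>{?G A B | A B. ?I A B}. finite F \<and> disjoint F \<and> a - b = \<Union>F"
    \<comment> \<open>The points of a outside C in the first coordinate, and those inside C but
      outside D in the second.\<close>
    proof (intro exI[of _ "{(A - C) \<times> B, (A \<inter> C) \<times> (B - D)}"] conjI)
      show "{(A - C) \<times> B, (A \<inter> C) \<times> (B - D)} \<subseteq> {?G A B | A B. ?I A B}"
      proof -
        have "A - C \<in> sets MX" "A \<inter> C \<in> sets MX" "B - D \<in> sets MY" by measurable
        then show ?thesis using \<open>B \<in> sets MY\<close> by blast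
      qed
      have "(A - C) \<times> B \<inter> (A \<inter> C) \<times> (B - D) = {}" by auto
      then show "disjoint {(A - C) \<times> B, (A \<inter> C) \<times> (B - D)}"
        unfolding disjoint_def by (simp add: Int_commute)
      show "a - b = \<Union>{(A - C) \<times> B, (A \<inter> C) \<times> (B - D)}" unfolding ab by auto
    qed simp
  qed
  have D: "emeasure D (A \<times> B) = ?\<mu> A B" if AB: "?I A B" for A B
  proof (rule extend_measure_caratheodory_pair[where P = ?I and G = ?G and \<mu> = ?\<mu>, OF D_def AB semi])
    fix A B C D
    assume I: "\<And>n. ?I (A n) (B n)" and CD: "?I C D"
      and dis: "disjoint_family (\<lambda>n :: nat. A n \<times> B n)" and un: "(\<Union>n. A n \<times> B n) = C \<times> D"
    have r: "range (\<lambda>n. A n \<times> B n) \<subseteq> sets (MX \<Otimes>\<^sub>M MY)" using I by auto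
    \<comment> \<open>Adding P (C x D) merges the truncated differences with P termwise into R;
      being finite, it is cancelled at the end.\<close>
    have "emeasure P (C \<times> D) + (\<Sum>n. ?\<mu> (A n) (B n)) = (\<Sum>n. emeasure P (A n \<times> B n)) + (\<Sum>n. ?\<mu> (A n) (B n))"
      using suminf_emeasure[of "\<lambda>n. A n \<times> B n" P] r dis by (simp add: sets un)
    also have "\<dots> = (\<Sum>n. emeasure P (A n \<times> B n) + ?\<mu> (A n) (B n))"
      by (rule suminf_add) auto
    also have "\<dots> = (\<Sum>n. emeasure R (A n \<times> B n))"
      using le I by (intro suminf_cong) (simp add: add_diff_inverse_ennreal)
    also have "\<dots> = emeasure R (C \<times> D)"
      using suminf_emeasure[of "\<lambda>n. A n \<times> B n" R] r dis by (simp add: sets un)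
    finally show "(\<Sum>n. ?\<mu> (A n) (B n)) = ?\<mu> C D"
      by (rule subst) (simp add: less_top[symmetric])
  qed auto
  have "emeasure R E = emeasure D E + emeasure P E"
    using Int_stable_pair_measure_generator closed E[unfolded sets_pair_measure]
  proof (induction rule: sigma_sets_induct_disjoint)
    case (basic A)
    then show ?case using D le by (auto simp: diff_add_cancel_ennreal)
  next
    case empty
    then show ?case by simp
  next
    case (compl A)
    then have A: "A \<in> sets R" "A \<in> sets D" "A \<in> sets P" by (simp_all add: sets sets_D sets_pair_measure)
    have split: "emeasure N A + emeasure N (?\<Omega> - A) = emeasure N ?\<Omega>" if "A \<in> sets N" "space N = ?\<Omega>" for N
    proof -
      have "?\<Omega> - A \<in> sets N" using that sets.compl_sets[of A N] by simp
      moreover have "A \<union> (?\<Omega> - A) = ?\<Omega>" using sets.sets_into_space[OF that(1)] that(2) by auto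
      ultimately show ?thesis using plus_emeasure[OF that(1), of "?\<Omega> - A"] by simp
    qed
    \<comment> \<open>Additivity for all three measures; the finite R A then cancels.\<close>
    have "emeasure R A + emeasure R (?\<Omega> - A) = emeasure D ?\<Omega> + emeasure P ?\<Omega>"
      using split[OF A(1)] D[of "space MX" "space MY"] le[of "space MX" "space MY"]
      by (simp add: space diff_add_cancel_ennreal)
    also have "\<dots> = emeasure R A + (emeasure D (?\<Omega> - A) + emeasure P (?\<Omega> - A))"
      unfolding compl.IH split[OF A(2) space(3), symmetric] split[OF A(3) space(1), symmetric]
      by (simp add: ac_simps)
    finally show ?case by (simp add: ennreal_add_left_cancel)
  next
    case (union A)
    then have r: "range A \<subseteq> sets R" "range A \<subseteq> sets D" "range A \<subseteq> sets P"
      by (auto simp: sets sets_D sets_pair_measure)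
    have "emeasure R (\<Union>i. A i) = (\<Sum>i. emeasure D (A i) + emeasure P (A i))"
      using suminf_emeasure[OF r(1) union(1)] union.IH by simp
    also have "\<dots> = emeasure D (\<Union>i. A i) + emeasure P (\<Union>i. A i)"
      unfolding suminf_emeasure[OF r(2) union(1), symmetric] suminf_emeasure[OF r(3) union(1), symmetric]
      by (rule suminf_add[symmetric]) auto
    finally show ?case .
  qed
  then show ?thesis by simp
qed

section \<open>Mutual information\<close>

context joint_law
begin

text \<open>The measure R with density g(y) with respect to the product of the marginals dominates P
  on rectangles, hence everywhere. Comparing the two on the event where g is smaller than dP / d(P_X
  x P_Y) shows that this event is null.\<close>

lemma leakage_density_ge_RN_deriv:
  assumes g: "leakage_density MX MY P g" and fin: "(\<integral>\<^sup>+z. g (snd z) \<partial>P) < \<top>"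
    and ac: "absolutely_continuous (distr P MX fst \<Otimes>\<^sub>M distr P MY snd) P"
  shows "AE z in distr P MX fst \<Otimes>\<^sub>M distr P MY snd.
    RN_deriv (distr P MX fst \<Otimes>\<^sub>M distr P MY snd) P z \<le> g (snd z)"
proof -
  let ?PX = "distr P MX fst" and ?PY = "distr P MY snd"
  let ?Q = "?PX \<Otimes>\<^sub>M ?PY"
  interpret PX: prob_space ?PX by (rule prob_space_distr) simp
  interpret PY: prob_space ?PY by (rule prob_space_distr) simp
  interpret Q: pair_prob_space ?PX ?PY ..
  have [measurable]: "g \<in> borel_measurable MY" using g by (simp add: leakage_density_def)
  have sets_Q: "sets ?Q = sets (MX \<Otimes>\<^sub>M MY)" by (intro sets_pair_measure_cong) simp_all
  have sets_PQ: "sets P = sets ?Q" using sets_Q by (simp add: sets_joint)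
  define f where "f = RN_deriv ?Q P"
  have [measurable]: "f \<in> borel_measurable ?Q" unfolding f_def by simp
  have density_f: "density ?Q f = P"
    unfolding f_def by (rule Q.density_RN_deriv[OF ac sets_PQ])
  \<comment> \<open>By Tonelli, R of a rectangle is exactly the right-hand side of the
    domination.\<close>
  have g_rect: "(\<integral>\<^sup>+z. g (snd z) * indicator (A \<times> B) z \<partial>?Q) =
      emeasure P (A \<times> space MY) * (\<integral>\<^sup>+z. g (snd z) * indicator B (snd z) \<partial>P)"
    if A[measurable]: "A \<in> sets MX" and B[measurable]: "B \<in> sets MY" for A B
  proof -
    have "(\<integral>\<^sup>+z. g (snd z) * indicator (A \<times> B) z \<partial>?Q) =
        (\<integral>\<^sup>+x. \<integral>\<^sup>+y. g y * indicator (A \<times> B) (x, y) \<partial>?PY \<partial>?PX)"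
      by (subst PY.nn_integral_fst[symmetric]) auto
    also have "\<dots> = (\<integral>\<^sup>+x. indicator A x * (\<integral>\<^sup>+y. g y * indicator B y \<partial>?PY) \<partial>?PX)"
      by (subst nn_integral_cmult[symmetric]) (auto simp: indicator_times mult_ac)
    also have "\<dots> = emeasure ?PX A * (\<integral>\<^sup>+y. g y * indicator B y \<partial>?PY)"
      by (subst nn_integral_multc) auto
    also have "emeasure ?PX A = emeasure P (A \<times> space MY)"
      using sets.sets_into_space[OF A]
      by (subst emeasure_distr) (auto simp: space_joint intro!: arg_cong[where f="emeasure P"])
    also have "(\<integral>\<^sup>+y. g y * indicator B y \<partial>?PY) = (\<integral>\<^sup>+z. g (snd z) * indicator B (snd z) \<partial>P)"
      by (subst nn_integral_distr) auto
    finally show ?thesis .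
  qed
  have gQ: "(\<lambda>z. g (snd z)) \<in> borel_measurable ?Q" by measurable
  define R where "R = density ?Q (\<lambda>z. g (snd z))"
  have sets_R: "sets R = sets (MX \<Otimes>\<^sub>M MY)" by (simp add: R_def sets_Q)
  have R_total: "(\<integral>\<^sup>+z. g (snd z) \<partial>?Q) < \<top>"
  proof -
    have "(\<integral>\<^sup>+z. g (snd z) \<partial>?Q) = (\<integral>\<^sup>+z. g (snd z) * indicator (space MX \<times> space MY) z \<partial>?Q)"
      by (intro nn_integral_cong) (auto simp: space_pair_measure)
    also have "\<dots> = (\<integral>\<^sup>+z. g (snd z) * indicator (space MY) (snd z) \<partial>P)"
      by (subst g_rect) (auto simp: space_joint[symmetric] emeasure_space_1)
    also have "\<dots> = (\<integral>\<^sup>+z. g (snd z) \<partial>P)"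
      by (intro nn_integral_cong) (auto simp: space_joint)
    finally show ?thesis using fin by simp
  qed
  have "finite_measure R"
  proof
    have "emeasure R (space R) = (\<integral>\<^sup>+z. g (snd z) * indicator (space ?Q) z \<partial>?Q)"
      unfolding R_def space_density by (rule emeasure_density[OF _ sets.top]) simp
    also have "\<dots> = (\<integral>\<^sup>+z. g (snd z) \<partial>?Q)"
      by (intro nn_integral_cong) simp
    finally show "emeasure R (space R) \<noteq> \<infinity>" using R_total by simp
  qed
  have le: "emeasure P E \<le> emeasure R E" if "E \<in> sets (MX \<Otimes>\<^sub>M MY)" for E
  proof (rule emeasure_pair_mono_rectangles[OF sets_joint sets_R _ \<open>finite_measure R\<close> _ that])
    show "finite_measure P" by (rule finite_measureI) simp
    fix A B assume A: "A \<in> sets MX" and B: "B \<in> sets MY"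
    then have "A \<times> B \<in> sets ?Q" by (simp add: sets_Q)
    then have "emeasure R (A \<times> B) = emeasure P (A \<times> space MY) * (\<integral>\<^sup>+z. g (snd z) * indicator B (snd z) \<partial>P)"
      unfolding R_def using A B by (subst emeasure_density) (auto simp: g_rect)
    then show "emeasure P (A \<times> B) \<le> emeasure R (A \<times> B)"
      using g A B by (simp add: leakage_density_def)
  qed
  define E where "E = {z \<in> space ?Q. g (snd z) < f z}"
  have E[measurable]: "E \<in> sets ?Q" unfolding E_def by measurable
  have "E \<in> sets (MX \<Otimes>\<^sub>M MY)" using E sets_Q by simp
  from le[OF this] have le_E: "(\<integral>\<^sup>+z. f z * indicator E z \<partial>?Q) \<le> (\<integral>\<^sup>+z. g (snd z) * indicator E z \<partial>?Q)"
    unfolding R_def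
    by (subst (asm) density_f[symmetric]) (simp only: emeasure_density[OF \<open>f \<in> borel_measurable ?Q\<close> E] emeasure_density[OF gQ E])
  \<comment> \<open>Finiteness permits subtracting the integrals over E.\<close>
  have fin_E: "(\<integral>\<^sup>+z. g (snd z) * indicator E z \<partial>?Q) < \<top>"
    by (rule order.strict_trans1[OF _ R_total]) (auto intro!: nn_integral_mono split: split_indicator)
  have "(\<integral>\<^sup>+z. f z * indicator E z - g (snd z) * indicator E z \<partial>?Q) =
      (\<integral>\<^sup>+z. f z * indicator E z \<partial>?Q) - (\<integral>\<^sup>+z. g (snd z) * indicator E z \<partial>?Q)"
    using fin_E by (intro nn_integral_diff AE_I2) (auto simp: E_def split: split_indicator)
  also have "\<dots> = 0" using le_E fin_E by (intro diff_eq_0_ennreal) auto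
  finally have "AE z in ?Q. f z * indicator E z - g (snd z) * indicator E z = 0"
    by (subst (asm) nn_integral_0_iff_AE) auto
  moreover have "AE z in ?Q. z \<in> space ?Q" by (rule AE_space)
  ultimately have "AE z in ?Q. f z \<le> g (snd z)"
  proof eventually_elim
    case (elim z)
    show ?case
    proof (rule ccontr)
      assume "\<not> f z \<le> g (snd z)"
      then have "z \<in> E" using elim(2) by (simp add: E_def not_le)
      then have "f z \<le> g (snd z)" using elim(1) by (intro ennreal_minus_eq_0) simp
      then show False using \<open>\<not> f z \<le> g (snd z)\<close> by simp
    qed
  qed
  then show ?thesis by (simp add: f_def)
qed

text \<open>The extended divergence is a difference of two integrals, so integrability needs care: g
  controls the positive part, and a divergent negative part could only give the value minus
  infinity.\<close>

lemma ext_KL_divergence_le_eln_guessing_gain: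
  assumes ac: "absolutely_continuous (distr P MX fst \<Otimes>\<^sub>M distr P MY snd) P"
  shows "ext_KL_divergence (distr P MX fst \<Otimes>\<^sub>M distr P MY snd) P \<le> eln (guessing_gain MX MY P)"
proof (cases "guessing_gain MX MY P")
  case (real s)
  let ?PX = "distr P MX fst" and ?PY = "distr P MY snd"
  let ?Q = "?PX \<Otimes>\<^sub>M ?PY"
  interpret PX: prob_space ?PX by (rule prob_space_distr) simp
  interpret PY: prob_space ?PY by (rule prob_space_distr) simp
  interpret Q: pair_prob_space ?PX ?PY ..
  have s1: "1 \<le> s" using guessing_gain_ge_1 real by simp
  have "guessing_gain MX MY P < \<top>" using real by simp
  then obtain g where g: "leakage_density MX MY P g" and "(\<integral>\<^sup>+z. g (snd z) \<partial>P) \<le> guessing_gain MX MY P"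
    using ex_leakage_density by blast
  then have g_int: "(\<integral>\<^sup>+z. g (snd z) \<partial>P) \<le> ennreal s" using real by simp
  then have g_fin: "(\<integral>\<^sup>+z. g (snd z) \<partial>P) < \<top>" by (rule order.strict_trans1) simp
  have [measurable]: "g \<in> borel_measurable MY" using g by (simp add: leakage_density_def)
  have sets_Q: "sets ?Q = sets (MX \<Otimes>\<^sub>M MY)" by (intro sets_pair_measure_cong) simp_all
  have sets_PQ: "sets P = sets ?Q" using sets_Q by (simp add: sets_joint)
  define f where "f = RN_deriv ?Q P"
  define h where "h = entropy_density (exp 1) ?Q P"
  have f_meas: "f \<in> borel_measurable ?Q" unfolding f_def by simp
  have [measurable]: "f \<in> borel_measurable P"
    using f_meas measurable_cong_sets[OF sets_PQ refl] by auto
  have h: "h z = ln (enn2real (f z))" for z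
    by (simp add: h_def f_def entropy_density_def log_def)
  have h_meas[measurable]: "h \<in> borel_measurable P"
    unfolding h[abs_def] by measurable
  have density_f: "density ?Q f = P"
    unfolding f_def by (rule Q.density_RN_deriv[OF ac sets_PQ])
  have f_le: "AE z in P. f z \<le> g (snd z)"
    using absolutely_continuous_AE[OF sets_PQ ac leakage_density_ge_RN_deriv[OF g g_fin ac]]
    by (simp add: f_def)
  \<comment> \<open>P has density f, so it does not charge the set f = 0, where the real logarithm
    has a default value.\<close>
  have f_pos: "AE z in P. 0 < f z"
    by (subst density_f[symmetric], subst AE_density[OF f_meas]) simp
  have g_fin_AE: "AE z in P. g (snd z) \<noteq> \<infinity>"
    using g_fin by (intro nn_integral_PInf_AE) auto
  let ?g = "\<lambda>z. enn2real (g (snd z))"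
  \<comment> \<open>The first bound is the tangent of ln at s; its correction has nonpositive mean
    because E g <= s. The second serves only to make the positive part of h integrable.\<close>
  have bounds: "AE z in P. h z \<le> ln s + ?g z / s - 1 \<and> h z \<le> ?g z"
    using f_le f_pos g_fin_AE
  proof eventually_elim
    case (elim z)
    then have "f z < \<top>" by (auto simp: less_top top_unique)
    with elim have f0: "0 < enn2real (f z)" by (simp add: enn2real_positive_iff)
    have fg: "enn2real (f z) \<le> ?g z" using elim by (intro enn2real_mono) (auto simp: less_top)
    have "ln (enn2real (f z)) = ln s + ln (enn2real (f z) / s)"
      using f0 s1 by (simp add: ln_div)
    also have "ln (enn2real (f z) / s) \<le> enn2real (f z) / s - 1"
      using f0 s1 by (intro ln_le_minus_one) simp
    also have "enn2real (f z) / s \<le> ?g z / s"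
      using fg s1 by (intro divide_right_mono) auto
    finally have "h z \<le> ln s + ?g z / s - 1" by (simp add: h)
    moreover have "h z \<le> ?g z" using ln_le_minus_one[OF f0] fg by (simp add: h)
    ultimately show ?case by simp
  qed
  have g_eq: "(\<integral>\<^sup>+z. ennreal (?g z) \<partial>P) = (\<integral>\<^sup>+z. g (snd z) \<partial>P)"
    using g_fin_AE by (intro nn_integral_cong_AE) (auto elim!: eventually_mono simp: less_top)
  have g_integrable: "integrable P ?g"
    using g_eq g_fin by (intro integrableI_nonneg) auto
  have g_expectation: "expectation ?g \<le> s"
    using g_eq g_int s1 by (subst integral_eq_nn_integral) (auto intro!: enn2real_leI)
  let ?p = "\<integral>\<^sup>+z. ennreal (h z) \<partial>P" and ?q = "\<integral>\<^sup>+z. ennreal (- h z) \<partial>P"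
  have "?p \<le> (\<integral>\<^sup>+z. ennreal (?g z) \<partial>P)"
    using bounds by (intro nn_integral_mono_AE) (auto elim!: eventually_mono intro!: ennreal_leI)
  then have p_fin: "?p < \<top>" using g_eq g_fin by order
  have KL: "ext_KL_divergence ?Q P = enn2ereal ?p - enn2ereal ?q"
    using ac by (simp add: ext_KL_divergence_def h_def)
  show ?thesis
  proof (cases "?q = \<top>")
    case True
    have "enn2ereal ?p \<noteq> \<infinity>" using p_fin by (cases ?p) auto
    then have "ext_KL_divergence ?Q P = -\<infinity>" using KL True by (cases "enn2ereal ?p") auto
    then show ?thesis by simp
  next
    case False
    then have h_integrable: "integrable P h"
      using p_fin unfolding real_integrable_def by auto
    have "expectation h \<le> expectation (\<lambda>z. ln s + ?g z / s - 1)"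
      using bounds h_integrable g_integrable by (intro integral_mono_AE) auto
    also have "\<dots> = ln s + expectation ?g / s - 1"
      using g_integrable by (simp add: prob_space)
    also have "\<dots> \<le> ln s" using g_expectation s1 by simp
    finally have "enn2real ?p - enn2real ?q \<le> ln s"
      using real_lebesgue_integral_def[OF h_integrable] by simp
    moreover have "ext_KL_divergence ?Q P = ereal (enn2real ?p - enn2real ?q)"
      using KL p_fin False by (cases ?p; cases ?q) auto
    ultimately show ?thesis
      using real s1 by (simp add: eln_ennreal elog_def)
  qed
qed (simp add: eln_def)

end

section \<open>Products\<close>

text \<open>A product of suprema is bounded by testing all choices of one element per factor. The
  free constant c absorbs the elements already chosen in the induction.\<close>

lemma prod_Sup_le_ennreal:
  fixes V :: "'i \<Rightarrow> ennreal set"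
  assumes "finite I" "\<And>w. (\<And>i. i \<in> I \<Longrightarrow> w i \<in> V i) \<Longrightarrow> c * (\<Prod>i\<in>I. w i) \<le> t"
  shows "c * (\<Prod>i\<in>I. Sup (V i)) \<le> t"
  using assms
proof (induction I arbitrary: c rule: finite_induct)
  case (insert i I)
  have "c * (\<Prod>j\<in>insert i I. Sup (V j)) = (c * (\<Prod>j\<in>I. Sup (V j))) * (SUP u\<in>V i. u)"
    using insert.hyps by (simp add: mult_ac)
  also have "\<dots> = (SUP u\<in>V i. c * (\<Prod>j\<in>I. Sup (V j)) * u)"
    by (rule SUP_mult_left_ennreal)
  also have "\<dots> \<le> t"
  proof (rule SUP_least)
    fix u assume u: "u \<in> V i"
    have "(c * u) * (\<Prod>j\<in>I. Sup (V j)) \<le> t"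
    proof (rule insert.IH)
      fix w assume w: "\<And>j. j \<in> I \<Longrightarrow> w j \<in> V j"
      have "c * (\<Prod>j\<in>insert i I. (w(i := u)) j) \<le> t"
        using u w by (intro insert.prems) auto
      moreover have "(\<Prod>j\<in>I. (w(i := u)) j) = (\<Prod>j\<in>I. w j)"
        using insert.hyps by (intro prod.cong) auto
      ultimately show "c * u * (\<Prod>j\<in>I. w j) \<le> t"
        using insert.hyps by (simp add: mult_ac)
    qed
    then show "c * (\<Prod>j\<in>I. Sup (V j)) * u \<le> t" by (simp add: mult_ac)
  qed
  finally show ?case .
qed simp

text \<open>\<open>nn_integral_subalgebra_le\<close> replaces the indicators of A and B by
  functions, one variable at a time. Functions are needed for products, where integrating out one
  coordinate of a set leaves a function of the others.\<close>

lemma (in joint_law) leakage_density_nn_integral: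
  assumes g: "leakage_density MX MY P g"
    and F[measurable]: "F \<in> borel_measurable MX" and G[measurable]: "G \<in> borel_measurable MY"
  shows "(\<integral>\<^sup>+z. F (fst z) * G (snd z) \<partial>P) \<le> (\<integral>\<^sup>+z. F (fst z) \<partial>P) * (\<integral>\<^sup>+z. G (snd z) * g (snd z) \<partial>P)"
proof -
  let ?FX = "vimage_algebra (space P) fst MX" and ?FY = "vimage_algebra (space P) snd MY"
  have [measurable]: "g \<in> borel_measurable MY" using g by (simp add: leakage_density_def)
  have fst_le: "(\<integral>\<^sup>+z. F (fst z) * indicator B (snd z) \<partial>P) \<le>
      (\<integral>\<^sup>+z. F (fst z) \<partial>P) * (\<integral>\<^sup>+z. g (snd z) * indicator B (snd z) \<partial>P)"
    if B[measurable]: "B \<in> sets MY" for B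
  proof -
    let ?G = "\<integral>\<^sup>+z. g (snd z) * indicator B (snd z) \<partial>P"
    have "(\<integral>\<^sup>+z. indicator B (snd z) * F (fst z) \<partial>P) \<le> (\<integral>\<^sup>+z. ?G * F (fst z) \<partial>P)"
    proof (rule nn_integral_subalgebra_le[OF subalgebra_vimage_algebra[OF measurable_fst_joint]])
      show "(\<lambda>z. F (fst z)) \<in> borel_measurable ?FX"
        by (rule measurable_comp_vimage_algebra) auto
      fix E assume "E \<in> sets ?FX"
      then obtain A where A[measurable]: "A \<in> sets MX" and E: "E = fst -` A \<inter> space P"
        by (auto simp: sets_vimage_algebra_measurable)
      have "(\<integral>\<^sup>+z. indicator B (snd z) * indicator E z \<partial>P) = (\<integral>\<^sup>+z. indicator (A \<times> B) z \<partial>P)"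
        unfolding E by (intro nn_integral_cong) (auto split: split_indicator)
      also have "\<dots> = emeasure P (A \<times> B)"
        by (intro nn_integral_indicator rectangle_joint A B)
      also have "\<dots> \<le> emeasure P (A \<times> space MY) * ?G"
        using g A B by (simp add: leakage_density_def)
      also have "emeasure P (A \<times> space MY) = (\<integral>\<^sup>+z. indicator (A \<times> space MY) z \<partial>P)"
        by (intro nn_integral_indicator[symmetric] rectangle_joint A sets.top)
      also have "\<dots> = (\<integral>\<^sup>+z. indicator E z \<partial>P)"
        unfolding E by (intro nn_integral_cong) (auto simp: space_joint split: split_indicator)
      also have "\<dots> * ?G = (\<integral>\<^sup>+z. ?G * indicator E z \<partial>P)"
        unfolding E by (subst nn_integral_cmult) (auto simp: mult.commute)
      finally show "(\<integral>\<^sup>+z. indicator B (snd z) * indicator E z \<partial>P) \<le> (\<integral>\<^sup>+z. ?G * indicator E z \<partial>P)" .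
    qed auto
    also have "\<dots> = ?G * (\<integral>\<^sup>+z. F (fst z) \<partial>P)"
      by (rule nn_integral_cmult) measurable
    finally show ?thesis by (simp add: mult.commute)
  qed
  let ?F = "\<integral>\<^sup>+z. F (fst z) \<partial>P"
  have "(\<integral>\<^sup>+z. F (fst z) * G (snd z) \<partial>P) \<le> (\<integral>\<^sup>+z. (?F * g (snd z)) * G (snd z) \<partial>P)"
  proof (rule nn_integral_subalgebra_le[OF subalgebra_vimage_algebra[OF measurable_snd_joint]])
    show "(\<lambda>z. G (snd z)) \<in> borel_measurable ?FY"
      by (rule measurable_comp_vimage_algebra) auto
    fix E assume "E \<in> sets ?FY"
    then obtain B where B[measurable]: "B \<in> sets MY" and E: "E = snd -` B \<inter> space P"
      by (auto simp: sets_vimage_algebra_measurable)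
    have "(\<integral>\<^sup>+z. F (fst z) * indicator E z \<partial>P) = (\<integral>\<^sup>+z. F (fst z) * indicator B (snd z) \<partial>P)"
      unfolding E by (intro nn_integral_cong) (auto split: split_indicator)
    also have "\<dots> \<le> ?F * (\<integral>\<^sup>+z. g (snd z) * indicator B (snd z) \<partial>P)" by (rule fst_le[OF B])
    also have "\<dots> = (\<integral>\<^sup>+z. ?F * (g (snd z) * indicator B (snd z)) \<partial>P)"
      by (rule nn_integral_cmult[symmetric]) measurable
    also have "\<dots> = (\<integral>\<^sup>+z. ?F * g (snd z) * indicator E z \<partial>P)"
      unfolding E by (intro nn_integral_cong) (auto split: split_indicator)
    finally show "(\<integral>\<^sup>+z. F (fst z) * indicator E z \<partial>P) \<le> (\<integral>\<^sup>+z. ?F * g (snd z) * indicator E z \<partial>P)" .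
  qed auto
  also have "\<dots> = ?F * (\<integral>\<^sup>+z. G (snd z) * g (snd z) \<partial>P)"
    by (subst nn_integral_cmult[symmetric]) (auto simp: mult_ac)
  finally show ?thesis .
qed

locale joint_law_family =
  fixes J :: "'i \<Rightarrow> ('b \<times> 'c) measure" and NX :: "'i \<Rightarrow> 'b measure" and NY :: "'i \<Rightarrow> 'c measure" and I :: "'i set"
  assumes joint: "\<And>i. joint_law (J i) (NX i) (NY i)" and finite_I: "finite I"
begin

sublocale joint_law "J i" "NX i" "NY i" for i by (rule joint)

sublocale product_prob_space J by unfold_locales

definition unzip :: "'i set \<Rightarrow> ('i \<Rightarrow> 'b \<times> 'c) \<Rightarrow> ('i \<Rightarrow> 'b) \<times> ('i \<Rightarrow> 'c)" where
  "unzip K z = (\<lambda>i\<in>K. fst (z i), \<lambda>i\<in>K. snd (z i))"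

lemma measurable_unzip_fst: "(\<lambda>z. \<lambda>i\<in>K. fst (z i)) \<in> measurable (PiM K J) (PiM K NX)"
  and measurable_unzip_snd: "(\<lambda>z. \<lambda>i\<in>K. snd (z i)) \<in> measurable (PiM K J) (PiM K NY)"
  by (intro measurable_restrict measurable_compose[OF measurable_component_singleton] measurable_fst_joint
      measurable_snd_joint; assumption)+

lemma measurable_unzip: "unzip K \<in> measurable (PiM K J) (PiM K NX \<Otimes>\<^sub>M PiM K NY)"
  unfolding unzip_def using measurable_unzip_fst measurable_unzip_snd by (rule measurable_Pair)

text \<open>Induction over coordinates. With the other coordinates fixed, the inequality for the law
  \<open>J i\<close> splits the inner integral into a function of the x's times a function of the
  y's, which is again of the form required by the induction hypothesis.\<close>

lemma leakage_density_nn_integral_PiM: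
  assumes "finite K" "\<And>i. i \<in> K \<Longrightarrow> leakage_density (NX i) (NY i) (J i) (g i)"
    and "F \<in> borel_measurable (PiM K NX)" "G \<in> borel_measurable (PiM K NY)"
  shows "(\<integral>\<^sup>+z. F (\<lambda>i\<in>K. fst (z i)) * G (\<lambda>i\<in>K. snd (z i)) \<partial>PiM K J) \<le>
    (\<integral>\<^sup>+z. F (\<lambda>i\<in>K. fst (z i)) \<partial>PiM K J) *
    (\<integral>\<^sup>+z. G (\<lambda>i\<in>K. snd (z i)) * (\<Prod>i\<in>K. g i (snd (z i))) \<partial>PiM K J)"
  using assms
proof (induction K arbitrary: F G rule: finite_induct)
  case empty
  then show ?case by (simp add: nn_integral_empty space_PiM_empty mult.assoc)
next
  case (insert i K)
  let ?K = "insert i K"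
  have [measurable]: "F \<in> borel_measurable (PiM ?K NX)" "G \<in> borel_measurable (PiM ?K NY)"
    by (rule insert.prems)+
  have [measurable]: "g j \<in> borel_measurable (NY j)" if "j \<in> ?K" for j
    using insert.prems(1)[OF that] by (simp add: leakage_density_def)
  have gi[measurable]: "g i \<in> borel_measurable (NY i)" by simp
  note measurable_unzip_fst[measurable] measurable_unzip_snd[measurable]
  \<comment> \<open>F and G with coordinate i integrated out. The factor \<open>g i\<close> is
    absorbed into G', since it belongs to the y side of the bound.\<close>
  define F' where "F' x = (\<integral>\<^sup>+w. F (x(i := fst w)) \<partial>J i)" for x
  define G' where "G' y = (\<integral>\<^sup>+w. G (y(i := snd w)) * g i (snd w) \<partial>J i)" for y
  have [measurable]: "(\<lambda>(x, w). F (x(i := fst w))) \<in> borel_measurable (PiM K NX \<Otimes>\<^sub>M J i)"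
    by measurable
  have [measurable]: "(\<lambda>(y, w). G (y(i := snd w)) * g i (snd w)) \<in> borel_measurable (PiM K NY \<Otimes>\<^sub>M J i)"
    by measurable
  have F'[measurable]: "F' \<in> borel_measurable (PiM K NX)" unfolding F'_def by measurable
  have G'[measurable]: "G' \<in> borel_measurable (PiM K NY)" unfolding G'_def by measurable
  have upd: "(\<lambda>j\<in>?K. h ((z(i := w)) j)) = (\<lambda>j\<in>K. h (z j))(i := h w)" for h :: "'b \<times> 'c \<Rightarrow> 'e" and z w
    using insert.hyps by (auto simp: restrict_def)
  have prod_upd: "(\<Prod>j\<in>?K. g j (snd ((z(i := w)) j))) = g i (snd w) * (\<Prod>j\<in>K. g j (snd (z j)))"
    for z :: "'i \<Rightarrow> 'b \<times> 'c" and w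
  proof -
    have "(\<Prod>j\<in>K. g j (snd ((z(i := w)) j))) = (\<Prod>j\<in>K. g j (snd (z j)))"
      using insert.hyps by (intro prod.cong) auto
    then show ?thesis by (simp add: prod.insert[OF insert.hyps])
  qed
  have restr_fst: "(\<lambda>j\<in>K. fst (z j)) \<in> space (PiM K NX)"
    and restr_snd: "(\<lambda>j\<in>K. snd (z j)) \<in> space (PiM K NY)" if "z \<in> space (PiM K J)" for z
    using that measurable_space[OF measurable_unzip_fst] measurable_space[OF measurable_unzip_snd] by auto
  have "(\<integral>\<^sup>+z. F (\<lambda>i\<in>?K. fst (z i)) * G (\<lambda>i\<in>?K. snd (z i)) \<partial>PiM ?K J) =
      (\<integral>\<^sup>+z. \<integral>\<^sup>+w. F ((\<lambda>j\<in>K. fst (z j))(i := fst w)) * G ((\<lambda>j\<in>K. snd (z j))(i := snd w)) \<partial>J i \<partial>PiM K J)"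
    by (subst product_nn_integral_insert[OF insert.hyps]) (simp_all only: upd, measurable)
  also have "\<dots> \<le> (\<integral>\<^sup>+z. F' (\<lambda>j\<in>K. fst (z j)) * G' (\<lambda>j\<in>K. snd (z j)) \<partial>PiM K J)"
  proof (rule nn_integral_mono)
    fix z assume z: "z \<in> space (PiM K J)"
    note [measurable] = restr_fst[OF z] restr_snd[OF z]
    show "(\<integral>\<^sup>+w. F ((\<lambda>j\<in>K. fst (z j))(i := fst w)) * G ((\<lambda>j\<in>K. snd (z j))(i := snd w)) \<partial>J i)
        \<le> F' (\<lambda>j\<in>K. fst (z j)) * G' (\<lambda>j\<in>K. snd (z j))"
      unfolding F'_def G'_def
      by (rule leakage_density_nn_integral[OF insert.prems(1)]) (simp, measurable)
  qed
  also have "\<dots> \<le> (\<integral>\<^sup>+z. F' (\<lambda>j\<in>K. fst (z j)) \<partial>PiM K J) *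
      (\<integral>\<^sup>+z. G' (\<lambda>j\<in>K. snd (z j)) * (\<Prod>j\<in>K. g j (snd (z j))) \<partial>PiM K J)"
    using insert.prems(1) F' G' by (intro insert.IH) auto
  also have "(\<integral>\<^sup>+z. F' (\<lambda>j\<in>K. fst (z j)) \<partial>PiM K J) = (\<integral>\<^sup>+z. F (\<lambda>i\<in>?K. fst (z i)) \<partial>PiM ?K J)"
    unfolding F'_def by (subst product_nn_integral_insert[OF insert.hyps]) (simp_all only: upd, measurable)
  also have "(\<integral>\<^sup>+z. G' (\<lambda>j\<in>K. snd (z j)) * (\<Prod>j\<in>K. g j (snd (z j))) \<partial>PiM K J) =
      (\<integral>\<^sup>+z. G (\<lambda>i\<in>?K. snd (z i)) * (\<Prod>i\<in>?K. g i (snd (z i))) \<partial>PiM ?K J)"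
  proof -
    have "(\<integral>\<^sup>+z. G (\<lambda>i\<in>?K. snd (z i)) * (\<Prod>i\<in>?K. g i (snd (z i))) \<partial>PiM ?K J) =
      (\<integral>\<^sup>+z. \<integral>\<^sup>+w. G ((\<lambda>j\<in>K. snd (z j))(i := snd w)) * (g i (snd w) * (\<Prod>j\<in>K. g j (snd (z j)))) \<partial>J i \<partial>PiM K J)"
      by (subst product_nn_integral_insert[OF insert.hyps]) (simp_all only: upd prod_upd, measurable)
    also have "\<dots> = (\<integral>\<^sup>+z. G' (\<lambda>j\<in>K. snd (z j)) * (\<Prod>j\<in>K. g j (snd (z j))) \<partial>PiM K J)"
    proof (rule nn_integral_cong)
      fix z assume z: "z \<in> space (PiM K J)"
      note [measurable] = restr_snd[OF z]
      show "(\<integral>\<^sup>+w. G ((\<lambda>j\<in>K. snd (z j))(i := snd w)) * (g i (snd w) * (\<Prod>j\<in>K. g j (snd (z j)))) \<partial>J i) =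
          G' (\<lambda>j\<in>K. snd (z j)) * (\<Prod>j\<in>K. g j (snd (z j)))"
        unfolding G'_def by (subst nn_integral_multc[symmetric]) (measurable, simp add: mult_ac)
    qed
    finally show ?thesis by simp
  qed
  finally show ?case .
qed

definition joint_product :: "(('i \<Rightarrow> 'b) \<times> ('i \<Rightarrow> 'c)) measure" where
  "joint_product = distr (PiM I J) (PiM I NX \<Otimes>\<^sub>M PiM I NY) (unzip I)"

lemma joint_law_joint_product: "joint_law joint_product (PiM I NX) (PiM I NY)"
proof -
  interpret prob_space "PiM I J" by (rule prob_space_PiM) unfold_locales
  interpret D: prob_space joint_product
    unfolding joint_product_def by (rule prob_space_distr) (rule measurable_unzip)
  show ?thesis by unfold_locales (simp add: joint_product_def)
qed

lemma nn_integral_joint_product: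
  "f \<in> borel_measurable (PiM I NX \<Otimes>\<^sub>M PiM I NY) \<Longrightarrow>
    (\<integral>\<^sup>+z. f z \<partial>joint_product) = (\<integral>\<^sup>+z. f (unzip I z) \<partial>PiM I J)"
  unfolding joint_product_def by (rule nn_integral_distr[OF measurable_unzip]) simp

text \<open>The functional inequality is applied to indicators of arbitrary measurable sets A and B
  of the product spaces, not just boxes. The total mass factors because the coordinates are
  independent.\<close>

lemma leakage_density_joint_product:
  assumes g: "\<And>i. i \<in> I \<Longrightarrow> leakage_density (NX i) (NY i) (J i) (g i)"
  shows "leakage_density (PiM I NX) (PiM I NY) joint_product (\<lambda>y. \<Prod>i\<in>I. g i (y i))"
    and "(\<integral>\<^sup>+z. (\<Prod>i\<in>I. g i (snd z i)) \<partial>joint_product) = (\<Prod>i\<in>I. \<integral>\<^sup>+z. g i (snd z) \<partial>J i)"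
proof -
  interpret JP: joint_law joint_product "PiM I NX" "PiM I NY" by (rule joint_law_joint_product)
  have gm: "g i \<in> borel_measurable (NY i)" if "i \<in> I" for i
    using g[OF that] by (simp add: leakage_density_def)
  have m[measurable]: "(\<lambda>y. \<Prod>i\<in>I. g i (y i)) \<in> borel_measurable (PiM I NY)"
    using gm by (intro borel_measurable_prod_ennreal measurable_compose[OF measurable_component_singleton]) auto
  have restr: "(\<Prod>i\<in>I. g i ((\<lambda>i\<in>I. snd (z i)) i)) = (\<Prod>i\<in>I. g i (snd (z i)))" for z
    by (intro prod.cong) auto
  show "leakage_density (PiM I NX) (PiM I NY) joint_product (\<lambda>y. \<Prod>i\<in>I. g i (y i))"
    unfolding leakage_density_def
  proof (intro conjI ballI m)
    fix A B assume A[measurable]: "A \<in> sets (PiM I NX)" and B[measurable]: "B \<in> sets (PiM I NY)"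
    have "emeasure joint_product (A \<times> B) = (\<integral>\<^sup>+z. indicator (A \<times> B) z \<partial>joint_product)"
      by (intro nn_integral_indicator[symmetric] JP.rectangle_joint A B)
    also have "\<dots> = (\<integral>\<^sup>+z. indicator A (\<lambda>i\<in>I. fst (z i)) * indicator B (\<lambda>i\<in>I. snd (z i)) \<partial>PiM I J)"
      by (subst nn_integral_joint_product) (auto simp: unzip_def indicator_times)
    also have "\<dots> \<le> (\<integral>\<^sup>+z. indicator A (\<lambda>i\<in>I. fst (z i)) \<partial>PiM I J) *
        (\<integral>\<^sup>+z. indicator B (\<lambda>i\<in>I. snd (z i)) * (\<Prod>i\<in>I. g i (snd (z i))) \<partial>PiM I J)"
      using g by (intro leakage_density_nn_integral_PiM finite_I) auto
    also have "(\<integral>\<^sup>+z. indicator A (\<lambda>i\<in>I. fst (z i)) \<partial>PiM I J) = (\<integral>\<^sup>+z. indicator A (fst z) \<partial>joint_product)"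
      by (subst nn_integral_joint_product) (auto simp: unzip_def)
    also have "\<dots> = (\<integral>\<^sup>+z. indicator (A \<times> space (PiM I NY)) z \<partial>joint_product)"
      by (intro nn_integral_cong) (auto simp: JP.space_joint split: split_indicator)
    also have "\<dots> = emeasure joint_product (A \<times> space (PiM I NY))"
      by (intro nn_integral_indicator JP.rectangle_joint A sets.top)
    also have "(\<integral>\<^sup>+z. indicator B (\<lambda>i\<in>I. snd (z i)) * (\<Prod>i\<in>I. g i (snd (z i))) \<partial>PiM I J) =
        (\<integral>\<^sup>+z. (\<Prod>i\<in>I. g i (snd z i)) * indicator B (snd z) \<partial>joint_product)"
      by (subst nn_integral_joint_product) (auto simp: unzip_def mult.commute)
    finally show "emeasure joint_product (A \<times> B) \<le> emeasure joint_product (A \<times> space (PiM I NY)) *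
        (\<integral>\<^sup>+z. (\<Prod>i\<in>I. g i (snd z i)) * indicator B (snd z) \<partial>joint_product)" .
  qed
  have "(\<integral>\<^sup>+z. (\<Prod>i\<in>I. g i (snd z i)) \<partial>joint_product) = (\<integral>\<^sup>+z. (\<Prod>i\<in>I. g i (snd (z i))) \<partial>PiM I J)"
    by (subst nn_integral_joint_product) (auto simp: unzip_def)
  also have "\<dots> = (\<Prod>i\<in>I. \<integral>\<^sup>+z. g i (snd z) \<partial>J i)"
    using gm by (intro product_nn_integral_prod finite_I measurable_compose[OF measurable_snd_joint])
  finally show "(\<integral>\<^sup>+z. (\<Prod>i\<in>I. g i (snd z i)) \<partial>joint_product) = (\<Prod>i\<in>I. \<integral>\<^sup>+z. g i (snd z) \<partial>J i)" .
qed

lemma measure_joint_product_PiE: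
  assumes A: "\<And>i. i \<in> I \<Longrightarrow> A i \<in> sets (NX i)" and B: "\<And>i. i \<in> I \<Longrightarrow> B i \<in> sets (NY i)"
  shows "measure joint_product (PiE I A \<times> PiE I B) = (\<Prod>i\<in>I. measure (J i) (A i \<times> B i))"
proof -
  have AB: "PiE I A \<in> sets (PiM I NX)" "PiE I B \<in> sets (PiM I NY)"
    using A B finite_I by (auto intro: sets_PiM_I_finite)
  have "unzip I -` (PiE I A \<times> PiE I B) \<inter> space (PiM I J) = PiE I (\<lambda>i. A i \<times> B i)"
  proof -
    have "z i \<in> space (J i)" if "z \<in> PiE I (\<lambda>i. A i \<times> B i)" "i \<in> I" for z i
    proof -
      have "A i \<times> B i \<subseteq> space (J i)"
        using A[OF that(2)] B[OF that(2)] by (intro sets.sets_into_space rectangle_joint)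
      then show ?thesis using that by (auto simp: PiE_iff)
    qed
    then show ?thesis
      by (auto simp: unzip_def space_PiM PiE_iff mem_Times_iff)
  qed
  then have "emeasure joint_product (PiE I A \<times> PiE I B) = emeasure (PiM I J) (PiE I (\<lambda>i. A i \<times> B i))"
    unfolding joint_product_def using AB by (subst emeasure_distr[OF measurable_unzip]) auto
  also have "\<dots> = (\<Prod>i\<in>I. emeasure (J i) (A i \<times> B i))"
    using A B by (intro emeasure_PiM finite_I rectangle_joint)
  also have "\<dots> = ennreal (\<Prod>i\<in>I. measure (J i) (A i \<times> B i))"
    using finite_measure.emeasure_eq_measure[OF prob_space.axioms(1)[OF joint_law.axioms(1)[OF joint]]]
    by (simp add: prod_ennreal)
  finally show ?thesis
    by (simp add: measure_def prod_nonneg)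
qed

text \<open>Upper bound: the product of the dual densities is a dual density of the product law.
  Lower bound: products of guessing sums are guessing sums over boxes.\<close>

lemma guessing_gain_joint_product:
  "guessing_gain (PiM I NX) (PiM I NY) joint_product = (\<Prod>i\<in>I. guessing_gain (NX i) (NY i) (J i))"
proof (rule antisym)
  interpret JP: joint_law joint_product "PiM I NX" "PiM I NY" by (rule joint_law_joint_product)
  show "guessing_gain (PiM I NX) (PiM I NY) joint_product \<le> (\<Prod>i\<in>I. guessing_gain (NX i) (NY i) (J i))"
  \<comment> \<open>An infinite factor makes the product infinite, since every other factor is at
    least 1.\<close>
  proof (cases "\<exists>i\<in>I. guessing_gain (NX i) (NY i) (J i) = \<top>")
    case True
    then have "(\<Prod>i\<in>I. guessing_gain (NX i) (NY i) (J i)) = \<top>"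
      using guessing_gain_ge_1 finite_I by (subst ennreal_prod_eq_top) (auto simp: not_one_le_zero, metis not_one_le_zero)
    then show ?thesis by simp
  next
    case False
    then have "\<exists>g. leakage_density (NX i) (NY i) (J i) g \<and>
        (\<integral>\<^sup>+z. g (snd z) \<partial>J i) \<le> guessing_gain (NX i) (NY i) (J i)" if "i \<in> I" for i
      using that by (intro ex_leakage_density) (auto simp: less_top)
    then obtain g where g: "\<And>i. i \<in> I \<Longrightarrow> leakage_density (NX i) (NY i) (J i) (g i)"
      and le: "\<And>i. i \<in> I \<Longrightarrow> (\<integral>\<^sup>+z. g i (snd z) \<partial>J i) \<le> guessing_gain (NX i) (NY i) (J i)"
      by metis
    have "guessing_gain (PiM I NX) (PiM I NY) joint_product \<le> (\<integral>\<^sup>+z. (\<Prod>i\<in>I. g i (snd z i)) \<partial>joint_product)"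
      by (rule JP.guessing_gain_le[OF leakage_density_joint_product(1)[OF g]])
    also have "\<dots> = (\<Prod>i\<in>I. \<integral>\<^sup>+z. g i (snd z) \<partial>J i)"
      by (rule leakage_density_joint_product(2)[OF g])
    also have "\<dots> \<le> (\<Prod>i\<in>I. guessing_gain (NX i) (NY i) (J i))"
      using finite_I le by (induction I rule: finite_induct) (auto intro!: mult_mono)
    finally show ?thesis .
  qed
  have "1 * (\<Prod>i\<in>I. guessing_gain (NX i) (NY i) (J i)) \<le> guessing_gain (PiM I NX) (PiM I NY) joint_product"
    unfolding guessing_gain_def[of "NX _"]
  proof (rule prod_Sup_le_ennreal[OF finite_I])
    let ?T = "\<lambda>i. {(n :: nat, A, B). A \<in> {..<n} \<rightarrow> sets (NX i) \<and> B \<in> {..<n} \<rightarrow> sets (NY i) \<and>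
        disjoint_family_on B {..<n}}"
    let ?v = "\<lambda>i (n, A, B). ennreal (\<Sum>j<n. measure (J i) (A j \<times> B j) / measure (J i) (A j \<times> space (NY i)))"
    fix w assume w: "\<And>i. i \<in> I \<Longrightarrow> w i \<in> ?v i ` ?T i"
    have "\<exists>t. \<forall>i\<in>I. t i \<in> T i \<and> w i = v i (t i)"
      if "\<And>i. i \<in> I \<Longrightarrow> w i \<in> v i ` T i" for T :: "'i \<Rightarrow> 'z set" and v
      using that by (intro bchoice) fast
    from this[of ?v ?T, OF w] obtain t where t: "\<forall>i\<in>I. t i \<in> ?T i \<and> w i = ?v i (t i)"
      by iprover
    define n where "n i = fst (t i)" for i
    define A where "A i = fst (snd (t i))" for i
    define B where "B i = snd (snd (t i))" for i
    have t_eq: "t i = (n i, A i, B i)" for i by (simp add: n_def A_def B_def)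
    have wi: "w i = ?v i (n i, A i, B i)" if "i \<in> I" for i
      unfolding t_eq[symmetric] by (rule conjunct2[OF bspec[OF t that]])
    have T: "(n i, A i, B i) \<in> ?T i" if "i \<in> I" for i
      unfolding t_eq[symmetric] by (rule conjunct1[OF bspec[OF t that]])
    have A: "A i j \<in> sets (NX i)" and B: "B i j \<in> sets (NY i)" if "i \<in> I" "j < n i" for i j
      using T[OF that(1)] that(2) by auto
    have dis: "B i j \<inter> B i k = {}" if "i \<in> I" "j < n i" "k < n i" "j \<noteq> k" for i j k
      using T[OF that(1)] that(2-) by (auto simp: disjoint_family_on_def)
    \<comment> \<open>A letter for the product law chooses one index per coordinate; its events are
      the corresponding boxes. Expanding the product of sums yields a sum over these
      choices.\<close>
    let ?K = "PiE I (\<lambda>i. {..<n i})"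
    let ?A = "\<lambda>k. PiE I (\<lambda>i. A i (k i))" and ?B = "\<lambda>k. PiE I (\<lambda>i. B i (k i))"
    let ?r = "\<lambda>i j. measure (J i) (A i j \<times> B i j) / measure (J i) (A i j \<times> space (NY i))"
    have "1 * (\<Prod>i\<in>I. w i) = (\<Prod>i\<in>I. ennreal (\<Sum>j<n i. ?r i j))"
      using wi by simp
    also have "\<dots> = ennreal (\<Prod>i\<in>I. \<Sum>j<n i. ?r i j)"
      by (rule prod_ennreal) (auto intro: sum_nonneg)
    also have "(\<Prod>i\<in>I. \<Sum>j<n i. ?r i j) = (\<Sum>k\<in>?K. \<Prod>i\<in>I. ?r i (k i))"
      using finite_I by (intro prod_sum_PiE) auto
    also have "\<dots> = (\<Sum>k\<in>?K. measure joint_product (?A k \<times> ?B k) / measure joint_product (?A k \<times> space (PiM I NY)))"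
    proof (rule sum.cong[OF refl])
      fix k assume k: "k \<in> ?K"
      then have ki: "k i < n i" if "i \<in> I" for i using that by (auto simp: PiE_iff)
      show "(\<Prod>i\<in>I. ?r i (k i)) = measure joint_product (?A k \<times> ?B k) / measure joint_product (?A k \<times> space (PiM I NY))"
        unfolding space_PiM using A B ki
        by (subst (1 2) measure_joint_product_PiE) (auto simp: prod_dividef)
    qed
    also have "ennreal \<dots> \<le> guessing_gain (PiM I NX) (PiM I NY) joint_product"
    proof (rule JP.guessing_gain_ge_finite)
      show "finite ?K" using finite_I by (intro finite_PiE) auto
      show "?A k \<in> sets (PiM I NX)" "?B k \<in> sets (PiM I NY)" if "k \<in> ?K" for k
        using that A B finite_I by (auto intro!: sets_PiM_I_finite simp: PiE_iff)
      show "disjoint_family_on ?B ?K"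
        unfolding disjoint_family_on_def
      proof (intro ballI impI)
        fix k l assume k: "k \<in> ?K" and l: "l \<in> ?K" and "k \<noteq> l"
        \<comment> \<open>Choices in \<open>PiE\<close> agree outside I, so distinct ones differ at
          some i in I, where the B's are already disjoint.\<close>
        then obtain i where i: "i \<in> I" "k i \<noteq> l i" by (metis PiE_ext)
        then have "B i (k i) \<inter> B i (l i) = {}" using k l by (intro dis) (auto simp: PiE_iff)
        then show "?B k \<inter> ?B l = {}" using i by (auto simp: PiE_iff)
      qed
    qed
    finally show "1 * (\<Prod>i\<in>I. w i) \<le> guessing_gain (PiM I NX) (PiM I NY) joint_product" .
  qed
  then show "(\<Prod>i\<in>I. guessing_gain (NX i) (NY i) (J i)) \<le> guessing_gain (PiM I NX) (PiM I NY) joint_product"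
    by simp
qed

end

text \<open>Independence identifies the law of the two tuples with \<open>joint_product\<close>,
  whose gain is a product; the logarithm turns it into a sum, as all gains are at least 1.\<close>

lemma (in prob_space) maximal_leakage_indep_pairs:
  assumes I: "finite I" "I \<noteq> {}"
    and indep: "indep_vars (\<lambda>i. NX i \<Otimes>\<^sub>M NY i) (\<lambda>i \<omega>. (X i \<omega>, Y i \<omega>)) I"
  shows "maximal_leakage (PiM I NX) (PiM I NY) (\<lambda>\<omega>. \<lambda>i\<in>I. X i \<omega>) (\<lambda>\<omega>. \<lambda>i\<in>I. Y i \<omega>) =
    (\<Sum>i\<in>I. maximal_leakage (NX i) (NY i) (X i) (Y i))"
proof -
  have XY: "random_variable (NX i \<Otimes>\<^sub>M NY i) (\<lambda>\<omega>. (X i \<omega>, Y i \<omega>))" if "i \<in> I" for i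
    using indep that by (auto simp: indep_vars_def)
  have X: "random_variable (NX i) (X i)" and Y: "random_variable (NY i) (Y i)" if "i \<in> I" for i
    using measurable_compose[OF XY[OF that] measurable_fst] measurable_compose[OF XY[OF that] measurable_snd]
    by simp_all
  obtain k where k: "k \<in> I" using I by auto
  \<comment> \<open>Indices outside \<open>I\<close> repeat a valid pair, since a product measure is indexed by a whole type.\<close>
  define c where "c i = (if i \<in> I then i else k)" for i
  have c: "c i \<in> I" for i using k by (simp add: c_def)
  define J where "J i = distr M (NX (c i) \<Otimes>\<^sub>M NY (c i)) (\<lambda>\<omega>. (X (c i) \<omega>, Y (c i) \<omega>))" for i
  interpret F: joint_law_family J "\<lambda>i. NX (c i)" "\<lambda>i. NY (c i)" I
    unfolding J_def by (rule joint_law_family.intro) (intro joint_law_distr X Y c, rule I)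
  have PiM_c: "PiM I (\<lambda>i. NX (c i)) = PiM I NX" "PiM I (\<lambda>i. NY (c i)) = PiM I NY"
    by (intro PiM_cong; simp add: c_def)+
  have "PiM I J = PiM I (\<lambda>i. distr M (NX i \<Otimes>\<^sub>M NY i) (\<lambda>\<omega>. (X i \<omega>, Y i \<omega>)))"
    by (intro PiM_cong) (simp_all add: J_def c_def)
  \<comment> \<open>Independence of the pairs says exactly that their joint law is the product of
    their laws.\<close>
  also have "\<dots> = distr M (PiM I (\<lambda>i. NX i \<Otimes>\<^sub>M NY i)) (\<lambda>\<omega>. \<lambda>i\<in>I. (X i \<omega>, Y i \<omega>))"
    using indep_vars_iff_distr_eq_PiM'[OF I(2) XY] indep by simp
  finally have PiM_J: "PiM I J = distr M (PiM I (\<lambda>i. NX i \<Otimes>\<^sub>M NY i)) (\<lambda>\<omega>. \<lambda>i\<in>I. (X i \<omega>, Y i \<omega>))" .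
  have "F.unzip I \<in> measurable (PiM I (\<lambda>i. NX i \<Otimes>\<^sub>M NY i)) (PiM I NX \<Otimes>\<^sub>M PiM I NY)"
    using F.measurable_unzip[of I] unfolding PiM_c PiM_J by simp
  then have law: "F.joint_product = distr M (PiM I NX \<Otimes>\<^sub>M PiM I NY) (\<lambda>\<omega>. (\<lambda>i\<in>I. X i \<omega>, \<lambda>i\<in>I. Y i \<omega>))"
    unfolding F.joint_product_def PiM_c PiM_J
    by (subst distr_distr) (auto intro!: measurable_restrict XY distr_cong restrict_ext simp: F.unzip_def)
  have "maximal_leakage (PiM I NX) (PiM I NY) (\<lambda>\<omega>. \<lambda>i\<in>I. X i \<omega>) (\<lambda>\<omega>. \<lambda>i\<in>I. Y i \<omega>) =
      eln (guessing_gain (PiM I NX) (PiM I NY) F.joint_product)"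
    unfolding law by (intro maximal_leakage_eq measurable_restrict X Y)
  also have "\<dots> = eln (\<Prod>i\<in>I. guessing_gain (NX (c i)) (NY (c i)) (J i))"
    using F.guessing_gain_joint_product by (simp add: PiM_c)
  also have "\<dots> = (\<Sum>i\<in>I. eln (guessing_gain (NX (c i)) (NY (c i)) (J i)))"
    by (intro eln_prod F.guessing_gain_ge_1)
  also have "\<dots> = (\<Sum>i\<in>I. maximal_leakage (NX i) (NY i) (X i) (Y i))"
    by (intro sum.cong refl) (simp add: maximal_leakage_eq X Y J_def c_def)
  finally show ?thesis .
qed

theorem corollary3:
  fixes MX :: "'a measure" and MY :: "'b measure" and P :: "('a \<times> 'b) measure"
  assumes "prob_space P"
    and "sets P = sets (MX \<Otimes>\<^sub>M MY)"
    and "absolutely_continuous (distr P MX fst \<Otimes>\<^sub>M distr P MY snd) P"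
    and "countably_generated MX"
  shows
    "(prob_space.maximal_leakage P MX MY fst snd = 0 \<longleftrightarrow>
      prob_space.indep_set P {fst -` A \<inter> space P | A. A \<in> sets MX}
        {snd -` B \<inter> space P | B. B \<in> sets MY}) \<and>
     (\<forall>(M :: 'o measure) (n :: nat) (NX :: nat \<Rightarrow> 'c measure) (NY :: nat \<Rightarrow> 'd measure) X Y.
        prob_space M \<and> 1 \<le> n \<and>
        prob_space.indep_vars M (\<lambda>i. NX i \<Otimes>\<^sub>M NY i) (\<lambda>i \<omega>. (X i \<omega>, Y i \<omega>)) {1..n} \<and>
        (\<forall>i\<in>{1..n}.
           absolutely_continuous (distr M (NX i) (X i) \<Otimes>\<^sub>M distr M (NY i) (Y i))
             (distr M (NX i \<Otimes>\<^sub>M NY i) (\<lambda>\<omega>. (X i \<omega>, Y i \<omega>))) \<and>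
           countably_generated (NX i)) \<longrightarrow>
        prob_space.maximal_leakage M (Pi\<^sub>M {1..n} NX) (Pi\<^sub>M {1..n} NY)
            (\<lambda>\<omega>. \<lambda>i\<in>{1..n}. X i \<omega>) (\<lambda>\<omega>. \<lambda>i\<in>{1..n}. Y i \<omega>) =
          (\<Sum>i = 1..n. prob_space.maximal_leakage M (NX i) (NY i) (X i) (Y i))) \<and>
     prob_space.ext_mutual_information P MX MY fst snd
       \<le> prob_space.maximal_leakage P MX MY fst snd"
proof -
  interpret joint_law P MX MY
    using assms(1,2) by (simp add: joint_law_def joint_law_axioms_def)
  \<comment> \<open>The variables are the coordinate projections on the space P itself, so their
    joint law is P.\<close>
  have law: "distr P (MX \<Otimes>\<^sub>M MY) (\<lambda>\<omega>. (fst \<omega>, snd \<omega>)) = P"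
    using sets_joint by (simp add: distr_id2)
  have leakage: "maximal_leakage MX MY fst snd = eln (guessing_gain MX MY P)"
    using maximal_leakage_eq[OF measurable_fst_joint measurable_snd_joint] by (simp only: law)
  have indep: "maximal_leakage MX MY fst snd = 0 \<longleftrightarrow>
      indep_set {fst -` A \<inter> space P | A. A \<in> sets MX} {snd -` B \<inter> space P | B. B \<in> sets MY}"
    by (simp only: leakage eln_eq_0_iff[OF guessing_gain_ge_1] guessing_gain_eq_1_iff)
  have info: "ext_mutual_information MX MY fst snd \<le> maximal_leakage MX MY fst snd"
    unfolding leakage ext_mutual_information_def law
    by (rule ext_KL_divergence_le_eln_guessing_gain[OF assms(3)])
  show ?thesis
    by (intro conjI allI impI indep info)
       (rule prob_space.maximal_leakage_indep_pairs; auto simp del: One_nat_def)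
qed

end
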